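(* Let $G$ be a Lie group modelled on a locally convex space. If $G$ has the strong Trotter property, then $G$ has the strong commutator property.
   Context: Conventions. Locally convex spaces are real and Hausdorff. A map $f:U\to F$ from an open subset $U$ of a locally convex space $E$ to a locally convex space $F$ is $C^1$ if it is continuous, $df(x,y)=\lim_{t\to0}t^{-1}(f(x+ty)-f(x))$ exists for all $(x,y)\in U\times E$, and $df$ is continuous; it is $C^k$ ($k\ge2$) if it is $C^1$ and $df$ is $C^{k-1}$; smooth means $C^k$ for all $k$. Manifolds and Lie groups modelled on locally convex spaces are defined with this notion. $e$ is the neutral element and $L(G)=T_eG$ the Lie algebra with its Lie bracket $[\cdot,\cdot]$. Both properties below presuppose that $G$ has a smooth exponential function $\exp_G:L(G)\to G$, i.e. for each $v\in L(G)$, $t\mapsto\exp_G(tv)$ is a smooth one-parameter group with derivative $v$ at $t=0$. $G$ has the strong Trotter property if for each $C^1$-curve $\gamma:[0,1]\to G$ with $\gamma(0)=e$, $(\gamma(t/n))^n\to\exp_G(t\gamma'(0))$ as $n\to\infty$, uniformly for $t$ in compact subsets of $[0,\infty[$ (where $n$ is taken large enough that $t/n\in[0,1]$). $G$ has the strong commutator property if for all $C^1$-curves $\gamma,\eta:[0,1]\to G$ with $\gamma(0)=\eta(0)=e$, $$\big(\gamma(\sqrt t/n)\,\eta(\sqrt t/n)\,\gamma(\sqrt t/n)^{-1}\,\eta(\sqrt t/n)^{-1}\big)^{n^2}\to\exp_G(t[\gamma'(0),\eta'(0)])\quad\text{as }n\to\infty,$$ uniformly for $t$ in compact subsets of $[0,\infty[$.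 Uniform convergence of $G$-valued maps is with respect to the group uniformity: for each identity neighbourhood $U\subseteq G$, the $n$-th term lies in $gU\cap Ug$ ($g$ the limit value) for all $t$ in the compact set and all sufficiently large $n$. *)

theory Defs
  imports "HOL-Analysis.Analysis" "HOL-Algebra.Coset"
begin

section \<open>Locally convex spaces\<close>

text \<open>Real Hausdorff locally convex spaces: Hausdorff topological vector spaces whose zero has a
  neighbourhood base of open convex sets. (Convexity is written out because the constant
  \<^const>\<open>convex\<close> cannot occur in a class specification.)\<close>

class locally_convex_space = real_vector + topological_ab_group_add + t2_space +
  assumes tendsto_scaleR_nhds: "LIM z (nhds r \<times>\<^sub>F nhds x). fst z *\<^sub>R snd z :> nhds (r *\<^sub>R x)"
    and convex_nhds_0_expanded: "open S \<Longrightarrow> 0 \<in> S \<Longrightarrow> \<exists>C. open C \<and> 0 \<in> C \<and> C \<subseteq> S \<and>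
      (\<forall>x\<in>C. \<forall>y\<in>C. \<forall>u\<ge>0. \<forall>v\<ge>0. u + v = 1 \<longrightarrow> u *\<^sub>R x + v *\<^sub>R y \<in> C)"

instance real_normed_vector \<subseteq> locally_convex_space
proof
  fix r :: real and x :: 'a
  show "LIM z (nhds r \<times>\<^sub>F nhds x). fst z *\<^sub>R snd z :> nhds (r *\<^sub>R x)"
    by (intro tendsto_scaleR filterlim_fst filterlim_snd)
next
  fix S :: "'a set"
  assume "open S" "0 \<in> S"
  then obtain e where "e > 0" "ball 0 e \<subseteq> S"
    by (meson openE)
  then show "\<exists>C. open C \<and> 0 \<in> C \<and> C \<subseteq> S \<and>
      (\<forall>x\<in>C. \<forall>y\<in>C. \<forall>u\<ge>0. \<forall>v\<ge>0. u + v = 1 \<longrightarrow> u *\<^sub>R x + v *\<^sub>R y \<in> C)"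
    using convex_ball[of "0 :: 'a" e] unfolding convex_def by (intro exI[of _ "ball 0 e"]) auto
qed

lemma convex_nhds_0:
  fixes S :: "'a::locally_convex_space set"
  shows "open S \<Longrightarrow> 0 \<in> S \<Longrightarrow> \<exists>C. open C \<and> 0 \<in> C \<and> convex C \<and> C \<subseteq> S"
  using convex_nhds_0_expanded[of S] unfolding convex_def by blast

lemma tendsto_scaleR_lcs:
  fixes g :: "'c \<Rightarrow> 'a::locally_convex_space"
  assumes "(f \<longlongrightarrow> a) F" "(g \<longlongrightarrow> b) F"
  shows "((\<lambda>x. f x *\<^sub>R g x) \<longlongrightarrow> a *\<^sub>R b) F"
  using filterlim_compose[OF tendsto_scaleR_nhds filterlim_Pair[OF assms]] by simp

instance prod :: (topological_monoid_add, topological_monoid_add) topological_monoid_add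
proof
  fix a b :: "'a \<times> 'b"
  have "((\<lambda>z. (fst (fst z) + fst (snd z), snd (fst z) + snd (snd z))) \<longlongrightarrow>
        (fst a + fst b, snd a + snd b)) (nhds a \<times>\<^sub>F nhds b)"
    by (intro tendsto_Pair tendsto_add tendsto_fst tendsto_snd filterlim_fst filterlim_snd)
  then show "LIM z (nhds a \<times>\<^sub>F nhds b). fst z + snd z :> nhds (a + b)"
    by (simp add: plus_prod_def)
qed

instance prod :: (topological_comm_monoid_add, topological_comm_monoid_add)
  topological_comm_monoid_add ..

instance prod :: (topological_group_add, topological_group_add) topological_group_add
proof
  fix a :: "'a \<times> 'b"
  have "((\<lambda>z. (- fst z, - snd z)) \<longlongrightarrow> (- fst a, - snd a)) (nhds a)"
    by (intro tendsto_Pair tendsto_minus tendsto_fst tendsto_snd filterlim_ident)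
  moreover have "uminus = (\<lambda>z::'a \<times> 'b. (- fst z, - snd z))"
    by (simp add: fun_eq_iff uminus_prod_def)
  ultimately show "(uminus \<longlongrightarrow> - a) (nhds a)"
    by (simp only: uminus_prod_def)
qed

instance prod :: (topological_ab_group_add, topological_ab_group_add) topological_ab_group_add ..

instance prod :: (locally_convex_space, locally_convex_space) locally_convex_space
proof
  fix r :: real and x :: "'a \<times> 'b"
  have "((\<lambda>z. (fst z *\<^sub>R fst (snd z), fst z *\<^sub>R snd (snd z))) \<longlongrightarrow>
        (r *\<^sub>R fst x, r *\<^sub>R snd x)) (nhds r \<times>\<^sub>F nhds x)"
    by (intro tendsto_Pair tendsto_scaleR_lcs tendsto_fst tendsto_snd filterlim_fst filterlim_snd)
  then show "LIM z (nhds r \<times>\<^sub>F nhds x). fst z *\<^sub>R snd z :> nhds (r *\<^sub>R x)"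
    by (simp add: scaleR_prod_def)
next
  fix S :: "('a \<times> 'b) set"
  assume "open S" "0 \<in> S"
  then obtain A B where AB: "open A" "open B" "(0::'a) \<in> A" "(0::'b) \<in> B" "A \<times> B \<subseteq> S"
    by (auto simp: zero_prod_def elim: open_prod_elim)
  obtain C where C: "open C" "0 \<in> C" "convex C" "C \<subseteq> A" using convex_nhds_0 AB by blast
  obtain D where D: "open D" "0 \<in> D" "convex D" "D \<subseteq> B" using convex_nhds_0 AB by blast
  have "open (C \<times> D)" "0 \<in> C \<times> D" "convex (C \<times> D)" "C \<times> D \<subseteq> S"
    using AB C D by (auto simp: zero_prod_def open_Times convex_Times)
  then show "\<exists>C. open C \<and> 0 \<in> C \<and> C \<subseteq> S \<and>
      (\<forall>x\<in>C. \<forall>y\<in>C. \<forall>u\<ge>0. \<forall>v\<ge>0. u + v = 1 \<longrightarrow> u *\<^sub>R x + v *\<^sub>R y \<in> C)"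
    unfolding convex_def by (intro exI[of _ "C \<times> D"]) simp
qed


section \<open>Maps of class C^k between locally convex spaces\<close>

text \<open>The recursion ``\<open>f\<close> is C^(k+1) iff \<open>f\<close> is C^1 and \<open>df : U \<times> E \<rightarrow> F\<close> is C^k'' changes the
  domain from \<open>E\<close> to \<open>E \<times> E\<close>, and hence its type. It is therefore carried out on the powers \<open>E^n\<close>,
  represented by the lists of length \<open>n\<close>; concatenation identifies \<open>E^n \<times> E^n\<close> with \<open>E^(n+n)\<close>.
  Lemmas \<open>Ck_on_0\<close> and \<open>Ck_on_Suc\<close> below recover the recursion in its usual form.\<close>

definition list_topology :: "nat \<Rightarrow> 'a::topological_space list topology" where
  "list_topology n = pullback_topology {xs. length xs = n} (\<lambda>xs. \<lambda>i\<in>{..<n}. xs ! i)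
     (product_topology (\<lambda>_. euclidean) {..<n})"

primrec Ck_list ::
  "nat \<Rightarrow> nat \<Rightarrow> 'a::locally_convex_space list set \<Rightarrow> ('a list \<Rightarrow> 'b::locally_convex_space) \<Rightarrow> bool"
where
  "Ck_list 0 n U f \<longleftrightarrow> continuous_map (subtopology (list_topology n) U) euclidean f"
| "Ck_list (Suc k) n U f \<longleftrightarrow>
     continuous_map (subtopology (list_topology n) U) euclidean f \<and>
     (\<exists>df. (\<forall>x\<in>U. \<forall>y. length y = n \<longrightarrow>
              ((\<lambda>t. (1 / t) *\<^sub>R (f (map2 (\<lambda>a b. a + t *\<^sub>R b) x y) - f x)) \<longlongrightarrow> df (x @ y)) (at 0)) \<and>
           Ck_list k (n + n) {x @ y |x y. x \<in> U \<and> length y = n} df)"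

definition Ck_on ::
  "nat \<Rightarrow> 'a::locally_convex_space set \<Rightarrow> ('a \<Rightarrow> 'b::locally_convex_space) \<Rightarrow> bool" where
  "Ck_on k U f \<longleftrightarrow> Ck_list k 1 ((\<lambda>x. [x]) ` U) (f \<circ> hd)"

definition smooth_on ::
  "'a::locally_convex_space set \<Rightarrow> ('a \<Rightarrow> 'b::locally_convex_space) \<Rightarrow> bool" where
  "smooth_on U f \<longleftrightarrow> (\<forall>k. Ck_on k U f)"

definition dir_deriv ::
  "('a::locally_convex_space \<Rightarrow> 'b::locally_convex_space) \<Rightarrow> 'a \<Rightarrow> 'a \<Rightarrow> 'b" where
  "dir_deriv f x y = Lim (at 0) (\<lambda>t. (1 / t) *\<^sub>R (f (x + t *\<^sub>R y) - f x))"

subsection \<open>The defining recursion\<close>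

lemma topspace_list_topology [simp]: "topspace (list_topology n) = {xs. length xs = n}"
  by (auto simp: list_topology_def topspace_pullback_topology)

lemma continuous_map_list_topology:
  "continuous_map X (list_topology n) g \<longleftrightarrow>
     (\<forall>x\<in>topspace X. length (g x) = n) \<and> (\<forall>i<n. continuous_map X euclidean (\<lambda>x. g x ! i))"
  (is "?L \<longleftrightarrow> ?R")
proof
  assume L: ?L
  let ?f = "\<lambda>xs. \<lambda>i\<in>{..<n}. (xs::'b list) ! i"
  have "continuous_map (list_topology n) (product_topology (\<lambda>_. euclidean) {..<n}) (id \<circ> ?f)"
    unfolding list_topology_def by (intro continuous_map_pullback continuous_map_id)
  then have c: "continuous_map X (product_topology (\<lambda>_. euclidean) {..<n}) (?f \<circ> g)"
    using continuous_map_compose[OF L] by simp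
  have "continuous_map X euclidean (\<lambda>x. g x ! i)" if "i < n" for i
    using c that unfolding continuous_map_componentwise by (auto simp: o_def)
  moreover have "\<forall>x\<in>topspace X. length (g x) = n"
    using L unfolding continuous_map_def by auto
  ultimately show ?R by blast
next
  assume R: ?R
  show ?L
    unfolding list_topology_def
  proof (rule continuous_map_pullback')
    show "continuous_map X (product_topology (\<lambda>_. euclidean) {..<n}) ((\<lambda>xs. \<lambda>i\<in>{..<n}. xs ! i) \<circ> g)"
      using R unfolding continuous_map_componentwise by (auto simp: o_def)
  qed (use R in auto)
qed

lemma continuous_map_nth_list_topology:
  "i < n \<Longrightarrow> continuous_map (list_topology n) euclidean (\<lambda>xs. xs ! i)"
  using continuous_map_list_topology[of "list_topology n" n "\<lambda>x. x"] by auto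

definition flat_pairs :: "('a \<times> 'a) list \<Rightarrow> 'a list" where
  "flat_pairs xs = concat (map (\<lambda>p. [fst p, snd p]) xs)"

fun unflat_pairs :: "'a list \<Rightarrow> ('a \<times> 'a) list" where
  "unflat_pairs (a # b # xs) = (a, b) # unflat_pairs xs"
| "unflat_pairs _ = []"

lemma flat_pairs_simps [simp]:
  "flat_pairs [] = []" "flat_pairs (p # xs) = fst p # snd p # flat_pairs xs"
  "flat_pairs (xs @ ys) = flat_pairs xs @ flat_pairs ys"
  by (auto simp: flat_pairs_def)

lemma length_flat_pairs [simp]: "length (flat_pairs xs) = length xs + length xs"
  by (induction xs) auto

lemma length_unflat_pairs [simp]: "length (unflat_pairs ys) = length ys div 2"
  by (induction ys rule: unflat_pairs.induct) auto

lemma nth_unflat_pairs: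
  "i < length ys div 2 \<Longrightarrow> unflat_pairs ys ! i = (ys ! (2 * i), ys ! (2 * i + 1))"
proof (induction ys arbitrary: i rule: unflat_pairs.induct)
  case (1 a b xs)
  then show ?case by (cases i) auto
qed auto

lemma nth_flat_pairs:
  "i < length xs + length xs \<Longrightarrow>
     flat_pairs xs ! i = (if even i then fst (xs ! (i div 2)) else snd (xs ! (i div 2)))"
proof (induction xs arbitrary: i)
  case (Cons p xs)
  consider "i = 0" | "i = 1" | j where "i = Suc (Suc j)"
    by (metis One_nat_def not0_implies_Suc)
  then show ?case
    by cases (use Cons in auto)
qed auto

lemma unflat_flat_pairs [simp]: "unflat_pairs (flat_pairs xs) = xs"
  by (induction xs) auto

lemma flat_unflat_even: "even (length ys) \<Longrightarrow> flat_pairs (unflat_pairs ys) = ys"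
  by (induction ys rule: unflat_pairs.induct) auto

lemma flat_unflat_pairs: "length ys = n + n \<Longrightarrow> flat_pairs (unflat_pairs ys) = ys"
  by (rule flat_unflat_even) auto

lemma flat_pairs_map2:
  "length x = length y \<Longrightarrow>
   flat_pairs (map2 (\<lambda>a b. a + t *\<^sub>R b) x y) =
   map2 (\<lambda>a b. a + t *\<^sub>R b) (flat_pairs x) (flat_pairs (y :: ('a::real_vector \<times> 'a) list))"
  by (induction x y rule: list_induct2) auto

lemma homeomorphic_maps_flat_pairs:
  "homeomorphic_maps (list_topology n) (list_topology (n + n))
     (flat_pairs :: ('a::topological_space \<times> 'a) list \<Rightarrow> _) unflat_pairs"
  unfolding homeomorphic_maps_def
proof (intro conjI)
  show "continuous_map (list_topology n) (list_topology (n + n))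
      (flat_pairs :: ('a \<times> 'a) list \<Rightarrow> _)"
    unfolding continuous_map_list_topology
  proof (intro conjI ballI allI impI)
    fix i assume i: "i < n + n"
    have n: "continuous_map (list_topology n) euclidean (\<lambda>xs::('a \<times> 'a) list. xs ! (i div 2))"
      using i by (intro continuous_map_nth_list_topology) auto
    have "continuous_map (list_topology n) euclidean (\<lambda>xs::('a \<times> 'a) list. fst (xs ! (i div 2)))"
      using continuous_map_compose[OF n, of euclidean fst]
      by (simp add: o_def continuous_on_fst)
    moreover have "continuous_map (list_topology n) euclidean (\<lambda>xs::('a \<times> 'a) list. snd (xs ! (i div 2)))"
      using continuous_map_compose[OF n, of euclidean snd]
      by (simp add: o_def continuous_on_snd)
    moreover have "flat_pairs xs ! i = (if even i then fst (xs ! (i div 2)) else snd (xs ! (i div 2)))"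
      if "length xs = n" for xs :: "('a \<times> 'a) list"
      using that i by (intro nth_flat_pairs) simp
    ultimately show "continuous_map (list_topology n) euclidean (\<lambda>xs::('a \<times> 'a) list. flat_pairs xs ! i)"
      by (cases "even i"; simp) (erule continuous_map_eq, simp)+
  qed auto
  show "continuous_map (list_topology (n + n)) (list_topology n)
      (unflat_pairs :: 'a list \<Rightarrow> _)"
    unfolding continuous_map_list_topology
  proof (intro conjI ballI allI impI)
    fix i assume i: "i < n"
    have "continuous_map (list_topology (n + n)) (prod_topology euclidean euclidean)
        (\<lambda>ys::'a list. (ys ! (2 * i), ys ! (2 * i + 1)))"
      using i by (intro continuous_map_pairedI continuous_map_nth_list_topology) auto
    then show "continuous_map (list_topology (n + n)) euclidean (\<lambda>ys::'a list. unflat_pairs ys ! i)"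
      unfolding prod_topology_euclidean
      by (rule continuous_map_eq) (use i in \<open>auto simp: nth_unflat_pairs\<close>)
  qed auto
qed (auto intro: flat_unflat_pairs)

lemma continuous_map_flat_pairs:
  assumes "V \<subseteq> {xs. length xs = n}"
  shows "continuous_map (subtopology (list_topology n) V) Y (f \<circ> flat_pairs) \<longleftrightarrow>
    continuous_map (subtopology (list_topology (n + n)) (flat_pairs ` V)) Y
      (f :: 'a::topological_space list \<Rightarrow> _)" (is "?L \<longleftrightarrow> ?R")
proof -
  let ?X = "subtopology (list_topology n) V"
  let ?Z = "subtopology (list_topology (n + n)) (flat_pairs ` V)"
  have h: "homeomorphic_maps ?X ?Z (flat_pairs :: ('a \<times> 'a) list \<Rightarrow> _) unflat_pairs"
    using homeomorphic_maps_flat_pairs by (rule homeomorphic_maps_subtopologies) (use assms in auto)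
  show ?thesis
  proof
    assume L: ?L
    have "continuous_map ?Z ?X unflat_pairs" using h by (simp add: homeomorphic_maps_def)
    from continuous_map_compose[OF this L] show ?R
      by (rule continuous_map_eq) (auto simp: o_def)
  next
    assume R: ?R
    have "continuous_map ?X ?Z (flat_pairs :: ('a \<times> 'a) list \<Rightarrow> _)"
      using h by (simp add: homeomorphic_maps_def)
    from continuous_map_compose[OF this R] show ?L .
  qed
qed

lemma Ck_list_cong:
  assumes "U \<subseteq> {xs. length xs = n}" "\<And>x. length x = n \<Longrightarrow> f x = g x" "Ck_list k n U f"
  shows "Ck_list k n U g"
proof (cases k)
  case 0
  then show ?thesis using assms by (auto elim!: continuous_map_eq)
next
  case (Suc m)
  have "continuous_map (subtopology (list_topology n) U) euclidean g"
    using assms by (auto simp: Suc elim!: continuous_map_eq)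
  moreover have "f (map2 h x y) - f x = g (map2 h x y) - g x"
    if "x \<in> U" "length y = n" for h :: "'a \<Rightarrow> 'a \<Rightarrow> 'a" and x y
    using assms that by (auto simp: subset_iff)
  moreover obtain df where df: "\<forall>x\<in>U. \<forall>y. length y = n \<longrightarrow>
      ((\<lambda>t. (1 / t) *\<^sub>R (f (map2 (\<lambda>a b. a + t *\<^sub>R b) x y) - f x)) \<longlongrightarrow> df (x @ y)) (at 0)"
    "Ck_list m (n + n) {x @ y |x y. x \<in> U \<and> length y = n} df"
    using assms(3) by (auto simp: Suc)
  ultimately show ?thesis unfolding Suc Ck_list.simps by (intro conjI exI[of _ df]) auto
qed

lemma Ck_list_flat_pairs:
  assumes "V \<subseteq> {xs. length xs = n}"
  shows "Ck_list k n V (f \<circ> flat_pairs) \<longleftrightarrow>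
    Ck_list k (n + n) (flat_pairs ` V)
      (f :: 'a::locally_convex_space list \<Rightarrow> 'b::locally_convex_space)"
  using assms
proof (induction k arbitrary: n V f)
  case 0
  then show ?case by (simp only: Ck_list.simps continuous_map_flat_pairs)
next
  case (Suc k)
  let ?d = "\<lambda>(df :: 'a list \<Rightarrow> 'b) x y.
    ((\<lambda>t. (1 / t) *\<^sub>R (f (map2 (\<lambda>a b. a + t *\<^sub>R b) x y) - f x)) \<longlongrightarrow> df (x @ y)) (at 0)"
  let ?W = "{x @ y |x y. x \<in> V \<and> length y = n}"
  let ?W' = "{x @ y |x y. x \<in> flat_pairs ` V \<and> length y = n + n}"
  have W: "?W \<subseteq> {xs. length xs = n + n}" using Suc.prems by auto
  have W': "?W' = flat_pairs ` ?W"
  proof (intro equalityI subsetI)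
    fix z assume "z \<in> ?W'"
    then obtain x y where "z = flat_pairs x @ y" "x \<in> V" "length y = n + n" by auto
    then have "z = flat_pairs (x @ unflat_pairs y)"
      by (auto simp: flat_unflat_pairs)
    moreover have "length (unflat_pairs y) = n" using \<open>length y = n + n\<close> by simp
    ultimately show "z \<in> flat_pairs ` ?W" using \<open>x \<in> V\<close> by blast
  next
    fix z assume "z \<in> flat_pairs ` ?W"
    then obtain x y where xy: "z = flat_pairs (x @ y)" "x \<in> V" "length y = n"
      by blast
    then have "z = flat_pairs x @ flat_pairs y" "length (flat_pairs y) = n + n"
      by simp_all
    with xy(2) show "z \<in> ?W'" by blast
  qed
  have all: "(\<forall>y::'a list. length y = n + n \<longrightarrow> P y) \<longleftrightarrow>
      (\<forall>y. length y = n \<longrightarrow> P (flat_pairs y))" for P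
  proof (intro iffI allI impI)
    fix y :: "'a list" assume "\<forall>y. length y = n \<longrightarrow> P (flat_pairs y)" "length y = n + n"
    moreover have "length (unflat_pairs y) = n" using \<open>length y = n + n\<close> by simp
    ultimately have "P (flat_pairs (unflat_pairs y))" by blast
    then show "P y" using flat_unflat_pairs \<open>length y = n + n\<close> by metis
  qed auto
  have d: "(\<forall>x\<in>V. \<forall>y. length y = n \<longrightarrow>
        ((\<lambda>t. (1 / t) *\<^sub>R ((f \<circ> flat_pairs) (map2 (\<lambda>a b. a + t *\<^sub>R b) x y) - (f \<circ> flat_pairs) x))
           \<longlongrightarrow> (df \<circ> flat_pairs) (x @ y)) (at 0)) \<longleftrightarrow>
      (\<forall>x\<in>flat_pairs ` V. \<forall>y. length y = n + n \<longrightarrow> ?d df x y)" for df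
    unfolding all using Suc.prems by (auto simp: flat_pairs_map2 subset_iff)
  have ex: "(\<exists>df :: ('a \<times> 'a) list \<Rightarrow> 'b. Q df) \<longleftrightarrow> (\<exists>df. Q (df \<circ> flat_pairs))" for Q
  proof
    assume "\<exists>df. Q df"
    then obtain df where "Q df" ..
    moreover have "(df \<circ> unflat_pairs) \<circ> flat_pairs = df" by (auto simp: fun_eq_iff)
    ultimately show "\<exists>df. Q (df \<circ> flat_pairs)" by (intro exI[of _ "df \<circ> unflat_pairs"]) simp
  qed auto
  have "Ck_list (Suc k) n V (f \<circ> flat_pairs) \<longleftrightarrow>
    continuous_map (subtopology (list_topology n) V) euclidean (f \<circ> flat_pairs) \<and>
    (\<exists>df. (\<forall>x\<in>flat_pairs ` V. \<forall>y. length y = n + n \<longrightarrow> ?d df x y) \<and>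
       Ck_list k (n + n) ?W (df \<circ> flat_pairs))"
    unfolding Ck_list.simps by (subst ex) (simp only: d)
  also have "\<dots> \<longleftrightarrow>
    continuous_map (subtopology (list_topology (n + n)) (flat_pairs ` V)) euclidean f \<and>
    (\<exists>df. (\<forall>x\<in>flat_pairs ` V. \<forall>y. length y = n + n \<longrightarrow> ?d df x y) \<and>
       Ck_list k (n + n + (n + n)) ?W' df)"
    by (simp only: continuous_map_flat_pairs[OF Suc.prems] Suc.IH[OF W] W')
  also have "\<dots> \<longleftrightarrow> Ck_list (Suc k) (n + n) (flat_pairs ` V) f"
    by simp
  finally show ?case .
qed

lemma continuous_map_singleton:
  "continuous_map (subtopology (list_topology 1) ((\<lambda>x. [x]) ` U)) Y (f \<circ> hd) \<longleftrightarrow>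
     continuous_map (top_of_set U) Y (f :: 'a::topological_space \<Rightarrow> _)" (is "?L \<longleftrightarrow> ?R")
proof -
  let ?X = "subtopology (list_topology 1) ((\<lambda>x::'a. [x]) ` U)"
  have 1: "continuous_map (top_of_set U) ?X (\<lambda>x. [x])"
    by (auto simp: continuous_map_in_subtopology continuous_map_list_topology)
  have "continuous_map ?X euclidean (\<lambda>xs. xs ! 0)"
    by (intro continuous_map_from_subtopology continuous_map_nth_list_topology) auto
  then have "continuous_map ?X euclidean hd"
    by (rule continuous_map_eq) auto
  then have 2: "continuous_map ?X (top_of_set U) hd"
    by (auto simp: continuous_map_in_subtopology)
  show ?thesis
  proof
    assume ?L from continuous_map_compose[OF 1 this] show ?R
      by (simp add: o_def)
  next
    assume ?R from continuous_map_compose[OF 2 this] show ?L .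
  qed
qed

lemma Ck_on_0: "Ck_on 0 U f \<longleftrightarrow> continuous_on U f"
  by (simp add: Ck_on_def continuous_map_singleton del: One_nat_def)

lemma Ck_on_Suc:
  fixes f :: "'a::locally_convex_space \<Rightarrow> 'b::locally_convex_space"
  shows "Ck_on (Suc k) U f \<longleftrightarrow> continuous_on U f \<and>
    (\<exists>df. (\<forall>x\<in>U. \<forall>y. ((\<lambda>t. (1 / t) *\<^sub>R (f (x + t *\<^sub>R y) - f x)) \<longlongrightarrow> df (x, y)) (at 0)) \<and>
          Ck_on k (U \<times> UNIV) df)"
proof -
  have all: "(\<forall>y::'a list. length y = 1 \<longrightarrow> P y) \<longleftrightarrow> (\<forall>y. P [y])" for P
    by (auto simp: length_Suc_conv)
  have dom: "{x @ y |x y. x \<in> (\<lambda>x. [x]) ` U \<and> length y = 1} =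
      flat_pairs ` (\<lambda>p. [p]) ` (U \<times> UNIV)"
  proof -
    have "{x @ y |x y. x \<in> (\<lambda>x. [x]) ` U \<and> length y = 1} = {[x, y] |x y. x \<in> U}"
    proof (intro equalityI subsetI)
      fix z assume "z \<in> {x @ y |x y. x \<in> (\<lambda>x. [x]) ` U \<and> length y = 1}"
      then obtain x y where "z = [x] @ y" "x \<in> U" "length y = 1" by blast
      then show "z \<in> {[x, y] |x y. x \<in> U}" by (cases y) auto
    next
      fix z assume "z \<in> {[x, y] |x y. x \<in> U}"
      then obtain x y where "z = [x] @ [y]" "x \<in> U" by auto
      moreover have "length [y] = 1" by simp
      ultimately show "z \<in> {x @ y |x y. x \<in> (\<lambda>x. [x]) ` U \<and> length y = 1}" by blast
    qed
    also have "\<dots> = flat_pairs ` (\<lambda>p. [p]) ` (U \<times> UNIV)"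
      by (force simp: image_image)
    finally show ?thesis .
  qed
  have C: "Ck_list k (1 + 1) (flat_pairs ` (\<lambda>p. [p]) ` (U \<times> UNIV)) df \<longleftrightarrow>
      Ck_on k (U \<times> UNIV) (\<lambda>p. df [fst p, snd p])" for df :: "'a list \<Rightarrow> 'b"
  proof -
    have "Ck_list k (1 + 1) (flat_pairs ` (\<lambda>p. [p]) ` (U \<times> UNIV)) df \<longleftrightarrow>
        Ck_list k 1 ((\<lambda>p. [p]) ` (U \<times> UNIV)) (df \<circ> flat_pairs)"
      by (rule Ck_list_flat_pairs[symmetric]) auto
    also have "\<dots> \<longleftrightarrow> Ck_list k 1 ((\<lambda>p. [p]) ` (U \<times> UNIV)) ((\<lambda>p. df [fst p, snd p]) \<circ> hd)"
      by (intro iffI; erule Ck_list_cong[rotated 2]) (auto simp: length_Suc_conv)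
    finally show ?thesis by (simp only: Ck_on_def)
  qed
  have ex: "(\<exists>df :: 'a list \<Rightarrow> 'b. Q (\<lambda>p. df [fst p, snd p])) \<longleftrightarrow> (\<exists>df. Q df)" for Q
  proof
    assume "\<exists>df. Q df"
    then obtain df where "Q df" ..
    then show "\<exists>df. Q (\<lambda>p. df [fst p, snd p])"
      by (intro exI[of _ "\<lambda>xs. df (xs ! 0, xs ! 1)"]) simp
  qed auto
  have "Ck_on (Suc k) U f \<longleftrightarrow> continuous_on U f \<and>
    (\<exists>df :: 'a list \<Rightarrow> 'b.
       (\<forall>x\<in>U. \<forall>y. ((\<lambda>t. (1 / t) *\<^sub>R (f (x + t *\<^sub>R y) - f x)) \<longlongrightarrow> df [x, y]) (at 0)) \<and>
       Ck_on k (U \<times> UNIV) (\<lambda>p. df [fst p, snd p]))"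
    unfolding Ck_on_def[of "Suc k"] Ck_list.simps dom C
    by (simp add: continuous_map_singleton all del: One_nat_def)
  also have "\<dots> \<longleftrightarrow> continuous_on U f \<and>
    (\<exists>df. (\<forall>x\<in>U. \<forall>y. ((\<lambda>t. (1 / t) *\<^sub>R (f (x + t *\<^sub>R y) - f x)) \<longlongrightarrow> df (x, y)) (at 0)) \<and>
          Ck_on k (U \<times> UNIV) df)"
    by (subst ex[symmetric]) simp
  finally show ?thesis .
qed


section \<open>Manifolds modelled on locally convex spaces\<close>

text \<open>A chart is a domain together with a map; the values of the map outside of the domain are
  irrelevant. A manifold is given by a topology and an atlas (not required to be maximal).\<close>

type_synonym ('m, 'e) chart = "'m set \<times> ('m \<Rightarrow> 'e)"

abbreviation chart_inv :: "('m, 'e) chart \<Rightarrow> 'e \<Rightarrow> 'm" where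
  "chart_inv c \<equiv> inv_into (fst c) (snd c)"

definition charts_at :: "('m, 'e) chart set \<Rightarrow> 'm \<Rightarrow> ('m, 'e) chart set" where
  "charts_at A p = {c \<in> A. p \<in> fst c}"

definition manifold :: "'m topology \<Rightarrow> ('m, 'e::locally_convex_space) chart set \<Rightarrow> bool" where
  "manifold T A \<longleftrightarrow>
     Hausdorff_space T \<and>
     \<Union> (fst ` A) = topspace T \<and>
     (\<forall>(U, \<phi>)\<in>A. openin T U \<and> open (\<phi> ` U) \<and>
        homeomorphic_map (subtopology T U) (top_of_set (\<phi> ` U)) \<phi>) \<and>
     (\<forall>(U, \<phi>)\<in>A. \<forall>(V, \<psi>)\<in>A. smooth_on (\<phi> ` (U \<inter> V)) (\<psi> \<circ> inv_into U \<phi>))"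

definition smooth_map ::
  "'m topology \<Rightarrow> ('m, 'e::locally_convex_space) chart set \<Rightarrow>
   'n topology \<Rightarrow> ('n, 'f::locally_convex_space) chart set \<Rightarrow> ('m \<Rightarrow> 'n) \<Rightarrow> bool" where
  "smooth_map T A T' A' f \<longleftrightarrow>
     continuous_map T T' f \<and>
     (\<forall>(U, \<phi>)\<in>A. \<forall>(V, \<psi>)\<in>A'. smooth_on (\<phi> ` (U \<inter> f -` V)) (\<psi> \<circ> f \<circ> inv_into U \<phi>))"

definition prod_atlas ::
  "('m, 'e) chart set \<Rightarrow> ('n, 'f) chart set \<Rightarrow> ('m \<times> 'n, 'e \<times> 'f) chart set" where
  "prod_atlas A B = {(U \<times> V, map_prod \<phi> \<psi>) |U \<phi> V \<psi>. (U, \<phi>) \<in> A \<and> (V, \<psi>) \<in> B}"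

subsection \<open>Tangent spaces\<close>

text \<open>A tangent vector at \<open>p\<close> assigns to each chart at \<open>p\<close> a vector of the model space, compatibly
  with the derivatives of the chart changes. The vector operations are the pointwise ones, and the
  topology is the one of pointwise convergence. For each chart \<open>c\<close> at \<open>p\<close>, evaluation at \<open>c\<close> is a
  linear homeomorphism onto the model space, hence a global chart of the tangent space.\<close>

type_synonym ('m, 'e) tvec = "('m, 'e) chart \<Rightarrow> 'e"

definition tangent_space ::
  "('m, 'e::locally_convex_space) chart set \<Rightarrow> 'm \<Rightarrow> ('m, 'e) tvec set" where
  "tangent_space A p = {v \<in> extensional (charts_at A p).
     \<forall>c\<in>charts_at A p. \<forall>c'\<in>charts_at A p.
       v c' = dir_deriv (snd c' \<circ> chart_inv c) (snd c p) (v c)}"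

definition tangent_topology ::
  "('m, 'e::locally_convex_space) chart set \<Rightarrow> 'm \<Rightarrow> ('m, 'e) tvec topology" where
  "tangent_topology A p =
     subtopology (product_topology (\<lambda>_. euclidean) (charts_at A p)) (tangent_space A p)"

definition tangent_atlas ::
  "('m, 'e::locally_convex_space) chart set \<Rightarrow> 'm \<Rightarrow> (('m, 'e) tvec, 'e) chart set" where
  "tangent_atlas A p = (\<lambda>c. (tangent_space A p, \<lambda>v. v c)) ` charts_at A p"

definition tangent_scale ::
  "('m, 'e::locally_convex_space) chart set \<Rightarrow> 'm \<Rightarrow> real \<Rightarrow> ('m, 'e) tvec \<Rightarrow> ('m, 'e) tvec" where
  "tangent_scale A p t v = (\<lambda>c\<in>charts_at A p. t *\<^sub>R v c)"

text \<open>For a differentiable map \<open>f\<close> and a tangent vector \<open>v\<close> at \<open>p\<close>, the chain rule shows that the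
  following does not depend on the chosen chart at \<open>p\<close>.\<close>

definition tangent_map ::
  "('m, 'e::locally_convex_space) chart set \<Rightarrow> ('n, 'f::locally_convex_space) chart set \<Rightarrow>
   ('m \<Rightarrow> 'n) \<Rightarrow> 'm \<Rightarrow> ('m, 'e) tvec \<Rightarrow> ('n, 'f) tvec" where
  "tangent_map A B f p v = (\<lambda>c'\<in>charts_at B (f p).
     let c = (SOME c. c \<in> charts_at A p)
     in dir_deriv (snd c' \<circ> f \<circ> chart_inv c) (snd c p) (v c))"

text \<open>The bracket of vector fields, which in a chart is \<open>[X, Y] = dY(X) - dX(Y)\<close>.\<close>

definition vector_field_bracket ::
  "('m, 'e::locally_convex_space) chart set \<Rightarrow> ('m \<Rightarrow> ('m, 'e) tvec) \<Rightarrow> ('m \<Rightarrow> ('m, 'e) tvec) \<Rightarrow>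
   'm \<Rightarrow> ('m, 'e) tvec" where
  "vector_field_bracket A X Y p = (\<lambda>c\<in>charts_at A p.
     let X' = (\<lambda>z. X (chart_inv c z) c); Y' = (\<lambda>z. Y (chart_inv c z) c); z = snd c p
     in dir_deriv Y' z (X' z) - dir_deriv X' z (Y' z))"

subsection \<open>Curves\<close>

definition curve_velocity ::
  "('m, 'e::locally_convex_space) chart set \<Rightarrow> real set \<Rightarrow> (real \<Rightarrow> 'm) \<Rightarrow> real \<Rightarrow> ('m, 'e) tvec" where
  "curve_velocity A I \<gamma> t = (\<lambda>c\<in>charts_at A (\<gamma> t).
     Lim (at t within I) (\<lambda>s. (1 / (s - t)) *\<^sub>R (snd c (\<gamma> s) - snd c (\<gamma> t))))"

text \<open>C^1-curves on \<open>[0,1]\<close>, with one-sided derivatives at the end points. The values of \<open>\<gamma>\<close> outside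
  of \<open>[0,1]\<close> are irrelevant.\<close>

definition C1_curve ::
  "'m topology \<Rightarrow> ('m, 'e::locally_convex_space) chart set \<Rightarrow> (real \<Rightarrow> 'm) \<Rightarrow> bool" where
  "C1_curve T A \<gamma> \<longleftrightarrow>
     continuous_map (top_of_set {0..1}) T \<gamma> \<and>
     (\<forall>(U, \<phi>)\<in>A. \<exists>\<delta>.
        (\<forall>t\<in>{0..1} \<inter> \<gamma> -` U.
           ((\<lambda>s. (1 / (s - t)) *\<^sub>R (\<phi> (\<gamma> s) - \<phi> (\<gamma> t))) \<longlongrightarrow> \<delta> t) (at t within {0..1})) \<and>
        continuous_on ({0..1} \<inter> \<gamma> -` U) \<delta>)"


section \<open>Lie groups\<close>

record ('g, 'e) lie_structure = "'g monoid" +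
  gtop :: "'g topology"
  gatlas :: "('g, 'e) chart set"

definition lie_group :: "('g, 'e::locally_convex_space) lie_structure \<Rightarrow> bool" where
  "lie_group G \<longleftrightarrow>
     group G \<and>
     topspace (gtop G) = carrier G \<and>
     manifold (gtop G) (gatlas G) \<and>
     smooth_map (prod_topology (gtop G) (gtop G)) (prod_atlas (gatlas G) (gatlas G))
       (gtop G) (gatlas G) (\<lambda>(x, y). x \<otimes>\<^bsub>G\<^esub> y) \<and>
     smooth_map (gtop G) (gatlas G) (gtop G) (gatlas G) (\<lambda>x. inv\<^bsub>G\<^esub> x)"

text \<open>The underlying space of the Lie algebra, and its bracket, the one of left invariant vector
  fields.\<close>

definition lie_algebra ::
  "('g, 'e::locally_convex_space) lie_structure \<Rightarrow> ('g, 'e) tvec set" where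
  "lie_algebra G = tangent_space (gatlas G) \<one>\<^bsub>G\<^esub>"

definition lie_scale ::
  "('g, 'e::locally_convex_space) lie_structure \<Rightarrow> real \<Rightarrow> ('g, 'e) tvec \<Rightarrow> ('g, 'e) tvec" where
  "lie_scale G = tangent_scale (gatlas G) \<one>\<^bsub>G\<^esub>"

definition left_invariant_field ::
  "('g, 'e::locally_convex_space) lie_structure \<Rightarrow> ('g, 'e) tvec \<Rightarrow> 'g \<Rightarrow> ('g, 'e) tvec" where
  "left_invariant_field G v g = tangent_map (gatlas G) (gatlas G) (\<lambda>h. g \<otimes>\<^bsub>G\<^esub> h) \<one>\<^bsub>G\<^esub> v"

definition lie_bracket ::
  "('g, 'e::locally_convex_space) lie_structure \<Rightarrow> ('g, 'e) tvec \<Rightarrow> ('g, 'e) tvec \<Rightarrow> ('g, 'e) tvec" where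
  "lie_bracket G v w =
     vector_field_bracket (gatlas G) (left_invariant_field G v) (left_invariant_field G w) \<one>\<^bsub>G\<^esub>"

definition smooth_exponential ::
  "('g, 'e::locally_convex_space) lie_structure \<Rightarrow> (('g, 'e) tvec \<Rightarrow> 'g) \<Rightarrow> bool" where
  "smooth_exponential G E \<longleftrightarrow>
     smooth_map (tangent_topology (gatlas G) \<one>\<^bsub>G\<^esub>) (tangent_atlas (gatlas G) \<one>\<^bsub>G\<^esub>)
       (gtop G) (gatlas G) E \<and>
     (\<forall>v\<in>lie_algebra G.
        smooth_map euclidean {(UNIV, id)} (gtop G) (gatlas G) (\<lambda>t::real. E (lie_scale G t v)) \<and>
        (\<forall>s t. E (lie_scale G (s + t) v) = E (lie_scale G s v) \<otimes>\<^bsub>G\<^esub> E (lie_scale G t v)) \<and>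
        curve_velocity (gatlas G) UNIV (\<lambda>t. E (lie_scale G t v)) 0 = v)"

text \<open>Convergence, uniform on compact subsets of \<open>[0,\<infinity>[\<close>, with respect to the group uniformity.\<close>

definition converges_compactly ::
  "('g, 'e::locally_convex_space) lie_structure \<Rightarrow> (nat \<Rightarrow> real \<Rightarrow> 'g) \<Rightarrow> (real \<Rightarrow> 'g) \<Rightarrow> bool" where
  "converges_compactly G f g \<longleftrightarrow>
     (\<forall>K U V. compact K \<and> K \<subseteq> {0..} \<and> openin (gtop G) V \<and> \<one>\<^bsub>G\<^esub> \<in> V \<and> V \<subseteq> U \<and> U \<subseteq> carrier G \<longrightarrow>
        (\<forall>\<^sub>F n in sequentially. \<forall>t\<in>K. f n t \<in> (g t <#\<^bsub>G\<^esub> U) \<inter> (U #>\<^bsub>G\<^esub> g t)))"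

text \<open>The two properties below are stated for the exponential function \<open>E\<close> of \<open>G\<close>, which is
  uniquely determined on the Lie algebra if it exists. For \<open>t\<close> in a fixed compact set the arguments of the curves lie in
  \<open>[0,1]\<close> for all sufficiently large \<open>n\<close>, so that their values elsewhere play no role.\<close>

definition strong_trotter_property ::
  "('g, 'e::locally_convex_space) lie_structure \<Rightarrow> (('g, 'e) tvec \<Rightarrow> 'g) \<Rightarrow> bool" where
  "strong_trotter_property G E \<longleftrightarrow>
     smooth_exponential G E \<and>
     (\<forall>\<gamma>. C1_curve (gtop G) (gatlas G) \<gamma> \<and> \<gamma> 0 = \<one>\<^bsub>G\<^esub> \<longrightarrow>
        converges_compactly G
          (\<lambda>n t. \<gamma> (t / real n) [^]\<^bsub>G\<^esub> n)
          (\<lambda>t. E (lie_scale G t (curve_velocity (gatlas G) {0..1} \<gamma> 0))))"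

definition strong_commutator_property ::
  "('g, 'e::locally_convex_space) lie_structure \<Rightarrow> (('g, 'e) tvec \<Rightarrow> 'g) \<Rightarrow> bool" where
  "strong_commutator_property G E \<longleftrightarrow>
     smooth_exponential G E \<and>
     (\<forall>\<gamma> \<eta>. C1_curve (gtop G) (gatlas G) \<gamma> \<and> \<gamma> 0 = \<one>\<^bsub>G\<^esub> \<and>
             C1_curve (gtop G) (gatlas G) \<eta> \<and> \<eta> 0 = \<one>\<^bsub>G\<^esub> \<longrightarrow>
        converges_compactly G
          (\<lambda>n t. (\<gamma> (sqrt t / real n) \<otimes>\<^bsub>G\<^esub> \<eta> (sqrt t / real n) \<otimes>\<^bsub>G\<^esub>
                  inv\<^bsub>G\<^esub> (\<gamma> (sqrt t / real n)) \<otimes>\<^bsub>G\<^esub> inv\<^bsub>G\<^esub> (\<eta> (sqrt t / real n))) [^]\<^bsub>G\<^esub> (n\<^sup>2))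
          (\<lambda>t. E (lie_scale G t (lie_bracket G
                    (curve_velocity (gatlas G) {0..1} \<gamma> 0)
                    (curve_velocity (gatlas G) {0..1} \<eta> 0)))))"

end

theory Submission
  imports Defs
begin

text \<open>Let \<open>\<kappa>(s) = \<gamma>(s)\<eta>(s)\<gamma>(s)\<^sup>-\<^sup>1\<eta>(s)\<^sup>-\<^sup>1\<close> and \<open>\<zeta>(t) = \<kappa>(\<surd>t)\<close>. Once \<open>\<zeta>\<close> is known to be a C^1-curve with
  \<open>\<zeta>'(0) = [\<gamma>'(0), \<eta>'(0)]\<close>, the strong Trotter property for \<open>\<zeta>\<close>, along the subsequence \<open>n\<^sup>2\<close>, is the
  claim. Only the parameter 0 is critical. In a chart, the commutator map \<open>F\<close> is constant on both axes,
  so that its partial derivatives \<open>dF(x, 0; u, 0)\<close> and \<open>dF(0, y; 0, w)\<close> vanish; differentiating them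
  once more gives \<open>\<kappa>'(s)/(2s) \<rightarrow> L\<close> and \<open>\<kappa>(s)/s\<^sup>2 \<rightarrow> L\<close> with \<open>L\<close> the mixed second derivative of \<open>F\<close>.
  The limit is identified by comparing \<open>\<kappa> \<cdot> \<eta>\<gamma> = \<gamma>\<eta>\<close> with the second order expansion of
  \<open>\<gamma>\<eta> - \<eta>\<gamma>\<close>, whose coefficients are the mixed derivatives of the multiplication
  that define the bracket.\<close>

section \<open>Calculus in locally convex spaces\<close>

text \<open>The curves are only C^1, so neither they nor \<kappa> have a second order Taylor
  expansion at hand, and the chain rule does not apply to \<kappa>(\<surd>t) at 0, where the square
  root has no derivative. All second order information is therefore drawn from smooth maps of two
  variables, which the curves enter only through mixed second differences; for these, first order
  asymptotics of the increments suffice.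

  Convergence of \<kappa>(s)/s^2 would give no more than differentiability of \<zeta> at 0. The
  limit of \<kappa>'(s)/(2s) makes the velocity continuous there, and the symmetry of second
  derivatives makes the two limits agree.

  In \<gamma>\<eta> - \<eta>\<gamma> the single coordinates of \<gamma> and \<eta>, whose second
  order behaviour is unknown, occur in both products and cancel. In \<kappa> \<cdot> \<eta>\<gamma>
  = \<gamma>\<eta> the factor \<eta>\<gamma> tends to the neutral element, where the derivative of
  the multiplication in its left argument is the identity; so \<kappa> and \<gamma>\<eta> -
  \<eta>\<gamma> have the same limit after division by s^2.\<close>

text \<open>The difference quotients over \<open>[a, c]\<close> are convex combinations of those over \<open>[a, b]\<close> and \<open>[b, c]\<close>,
  so bisection proves the mean value theorem without integrals, completeness or functionals.\<close>

lemma mean_value_convex: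
  fixes h :: "real \<Rightarrow> 'a::locally_convex_space"
  assumes "open C" "convex C"
    and lim: "\<And>\<tau>. \<tau> \<in> {0..1} \<Longrightarrow> ((\<lambda>\<epsilon>. (1 / \<epsilon>) *\<^sub>R (h (\<tau> + \<epsilon>) - h \<tau>)) \<longlongrightarrow> h' \<tau>) (at 0)"
    and C: "\<And>\<tau>. \<tau> \<in> {0..1} \<Longrightarrow> h' \<tau> \<in> C"
  shows "h 1 - h 0 \<in> C"
proof -
  \<comment> \<open>The guard a < b makes \<open>P a a\<close> true, so that bisection may use
    subintervals with \<tau> as an end point.\<close>
  define P where "P a b \<longleftrightarrow> (a < b \<longrightarrow> (1 / (b - a)) *\<^sub>R (h b - h a) \<in> C)" for a b :: real
  have tr: "P a c" if "P a b" "P b c" "a \<le> b" "b \<le> c" for a b c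
  proof (cases "a < b \<and> b < c")
    case True
    have "((b - a) / (c - a)) *\<^sub>R ((1 / (b - a)) *\<^sub>R (h b - h a)) +
        ((c - b) / (c - a)) *\<^sub>R ((1 / (c - b)) *\<^sub>R (h c - h b)) \<in> C"
      using that True by (intro convexD[OF \<open>convex C\<close>]) (auto simp: P_def add_divide_distrib[symmetric])
    also have "((b - a) / (c - a)) *\<^sub>R ((1 / (b - a)) *\<^sub>R (h b - h a)) +
        ((c - b) / (c - a)) *\<^sub>R ((1 / (c - b)) *\<^sub>R (h c - h b)) = (1 / (c - a)) *\<^sub>R (h c - h a)"
      using True by (simp add: scaleR_add_right[symmetric])
    finally show ?thesis by (simp add: P_def)
  next
    case False
    then show ?thesis using that by (cases "a = b") auto
  qed
  have "P 0 1"
  proof (rule Bolzano)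
    fix \<tau> :: real assume \<tau>: "0 \<le> \<tau>" "\<tau> \<le> 1"
    have "\<forall>\<^sub>F \<epsilon> in at 0. (1 / \<epsilon>) *\<^sub>R (h (\<tau> + \<epsilon>) - h \<tau>) \<in> C"
      using topological_tendstoD[OF lim \<open>open C\<close> C] \<tau> by simp
    then obtain d where d: "d > 0"
      "\<forall>\<epsilon>\<in>UNIV. \<epsilon> \<noteq> 0 \<and> dist \<epsilon> 0 < d \<longrightarrow> (1 / \<epsilon>) *\<^sub>R (h (\<tau> + \<epsilon>) - h \<tau>) \<in> C"
      unfolding eventually_at by blast
    have "P a b" if "a \<le> \<tau>" "\<tau> \<le> b" "b - a < d" for a b
    proof (rule tr[of a \<tau> b])
      \<comment> \<open>The quotient over [a, \<tau>] equals the difference quotient at \<tau> with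
        the negative increment a - \<tau>.\<close>
      have "(1 / (\<tau> - a)) *\<^sub>R (h \<tau> - h a) = (- (1 / (\<tau> - a))) *\<^sub>R (h a - h \<tau>)"
        by (simp only: scaleR_minus_left scaleR_minus_right[symmetric] minus_diff_eq)
      also have "- (1 / (\<tau> - a)) = 1 / (a - \<tau>)"
        by (simp only: minus_divide_right minus_diff_eq)
      finally show "P a \<tau>"
        using d(2)[rule_format, of "a - \<tau>"] that by (simp add: P_def dist_real_def)
      show "P \<tau> b" using d(2)[rule_format, of "b - \<tau>"] that by (simp add: P_def dist_real_def)
    qed (use that in auto)
    then show "\<exists>d>0. \<forall>a b. a \<le> \<tau> \<and> \<tau> \<le> b \<and> b - a < d \<longrightarrow> P a b" using d(1) by blast
  qed (use tr in auto)
  then show ?thesis by (simp add: P_def)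
qed

lemma convex_nhds_base:
  fixes L :: "'a::locally_convex_space"
  assumes "open S" "L \<in> S"
  obtains C where "open C" "convex C" "L \<in> C" "C \<subseteq> S"
proof -
  have o: "open ((\<lambda>x. x + a) -` T)" if "open T" for T and a :: 'a
    using that by (intro open_vimage continuous_intros)
  obtain C where C: "open C" "0 \<in> C" "convex C" "C \<subseteq> (\<lambda>x. x + L) -` S"
    using convex_nhds_0[OF o[OF assms(1)], of L] assms(2) by auto
  have "convex ((\<lambda>x. x + (- L)) -` C)"
  proof (rule convexI)
    fix x y :: 'a and u v :: real
    assume "x \<in> (\<lambda>x. x + - L) -` C" "y \<in> (\<lambda>x. x + - L) -` C" "0 \<le> u" "0 \<le> v" "u + v = 1"
    then have "u *\<^sub>R (x - L) + v *\<^sub>R (y - L) \<in> C" using C(3) by (auto intro: convexD)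
    moreover have "u *\<^sub>R (x - L) + v *\<^sub>R (y - L) = u *\<^sub>R x + v *\<^sub>R y - (u + v) *\<^sub>R L"
      by (simp add: algebra_simps)
    ultimately show "u *\<^sub>R x + v *\<^sub>R y \<in> (\<lambda>x. x + - L) -` C"
      using \<open>u + v = 1\<close> by simp
  qed
  moreover have "(\<lambda>x. x + (- L)) -` C \<subseteq> S" using C(4) by force
  ultimately show thesis using that[of "(\<lambda>x. x + (- L)) -` C"] o[OF C(1), of "- L"] C(2) by simp
qed

lemma eventually_prod_principal:
  "(\<forall>\<^sub>F z in F \<times>\<^sub>F principal A. P z) \<longleftrightarrow> (\<forall>\<^sub>F x in F. \<forall>y\<in>A. P (x, y))"
proof
  assume "\<forall>\<^sub>F z in F \<times>\<^sub>F principal A. P z"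
  then obtain Q R where "eventually Q F" "\<forall>y\<in>A. R y" "\<And>x y. Q x \<Longrightarrow> R y \<Longrightarrow> P (x, y)"
    by (auto simp: eventually_prod_filter eventually_principal)
  then show "\<forall>\<^sub>F x in F. \<forall>y\<in>A. P (x, y)" by (auto elim: eventually_mono)
next
  assume *: "\<forall>\<^sub>F x in F. \<forall>y\<in>A. P (x, y)"
  show "\<forall>\<^sub>F z in F \<times>\<^sub>F principal A. P z"
    unfolding eventually_prod_filter
    by (intro exI[of _ "\<lambda>x. \<forall>y\<in>A. P (x, y)"] exI[of _ "\<lambda>y. y \<in> A"])
      (use * in \<open>auto simp: eventually_principal\<close>)
qed

text \<open>The product with \<^term>\<open>principal {0..1}\<close> expresses convergence uniform in the parameter \<open>\<tau>\<close>.\<close>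

lemma mean_value_tendsto:
  fixes h :: "'s \<Rightarrow> real \<Rightarrow> 'a::locally_convex_space"
  assumes lim: "\<forall>\<^sub>F s in F. \<forall>\<tau>\<in>{0..1}. ((\<lambda>\<epsilon>. (1 / \<epsilon>) *\<^sub>R (h s (\<tau> + \<epsilon>) - h s \<tau>)) \<longlongrightarrow> h' s \<tau>) (at 0)"
    and L: "((\<lambda>z. h' (fst z) (snd z)) \<longlongrightarrow> L) (F \<times>\<^sub>F principal {0..1})"
  shows "((\<lambda>s. h s 1 - h s 0) \<longlongrightarrow> L) F"
proof (rule topological_tendstoI)
  fix S assume "open S" "L \<in> S"
  then obtain C where C: "open C" "convex C" "L \<in> C" "C \<subseteq> S" by (rule convex_nhds_base)
  have "\<forall>\<^sub>F s in F. \<forall>\<tau>\<in>{0..1}. h' s \<tau> \<in> C"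
    using topological_tendstoD[OF L C(1,3)] by (auto simp: eventually_prod_principal)
  with lim show "\<forall>\<^sub>F s in F. h s 1 - h s 0 \<in> S"
  proof eventually_elim
    case (elim s)
    then show ?case using mean_value_convex[OF C(1,2), of "h s" "h' s"] C(4) by auto
  qed
qed

text \<open>A convex neighbourhood of 0 that contains g also contains \<tau> g for 0 \<le> \<tau>
  \<le> 1, which gives uniformity in \<tau>.\<close>

lemma tendsto_bounded_scaleR:
  fixes g :: "'s \<Rightarrow> 'a::locally_convex_space"
  assumes "(g \<longlongrightarrow> 0) F"
  shows "((\<lambda>z. snd z *\<^sub>R g (fst z)) \<longlongrightarrow> 0) (F \<times>\<^sub>F principal {0..1::real})"
proof (rule topological_tendstoI)
  fix S :: "'a set" assume "open S" "0 \<in> S"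
  then obtain C where C: "open C" "convex C" "0 \<in> C" "C \<subseteq> S" by (rule convex_nhds_base)
  have "\<forall>\<^sub>F s in F. g s \<in> C" using topological_tendstoD[OF assms C(1,3)] .
  then have "\<forall>\<^sub>F s in F. \<forall>\<tau>\<in>{0..1::real}. \<tau> *\<^sub>R g s \<in> S"
  proof eventually_elim
    case (elim s)
    have "\<tau> *\<^sub>R g s + (1 - \<tau>) *\<^sub>R 0 \<in> C" if "\<tau> \<in> {0..1}" for \<tau>
      using that by (intro convexD[OF C(2) elim C(3)]) auto
    then show ?case using C(4) by auto
  qed
  then show "\<forall>\<^sub>F z in F \<times>\<^sub>F principal {0..1::real}. snd z *\<^sub>R g (fst z) \<in> S"
    by (simp add: eventually_prod_principal)
qed

section \<open>Maps of class C^1 with an explicit derivative\<close>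

text \<open>\<open>Ck_on\<close> hides the derivative behind an existential quantifier. Here it is
  an argument, so that it can be evaluated, composed and differentiated again.\<close>

definition C1_with ::
  "'a::locally_convex_space set \<Rightarrow> ('a \<Rightarrow> 'b::locally_convex_space) \<Rightarrow> ('a \<times> 'a \<Rightarrow> 'b) \<Rightarrow> bool" where
  "C1_with U f df \<longleftrightarrow> open U \<and> continuous_on U f \<and> continuous_on (U \<times> UNIV) df \<and>
     (\<forall>x\<in>U. \<forall>y. ((\<lambda>t. (1 / t) *\<^sub>R (f (x + t *\<^sub>R y) - f x)) \<longlongrightarrow> df (x, y)) (at 0))"

lemma C1_withD:
  assumes "C1_with U f df"
  shows "open U" "continuous_on U f" "continuous_on (U \<times> UNIV) df"
    "x \<in> U \<Longrightarrow> ((\<lambda>t. (1 / t) *\<^sub>R (f (x + t *\<^sub>R y) - f x)) \<longlongrightarrow> df (x, y)) (at 0)"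
  using assms by (auto simp: C1_with_def)

lemma Ck_on_1_iff:
  "open U \<Longrightarrow> Ck_on (Suc 0) U f \<longleftrightarrow> (\<exists>df. C1_with U f df)"
  by (auto simp: Ck_on_Suc Ck_on_0 C1_with_def)

lemma tendsto_line:
  fixes x y :: "'a::locally_convex_space"
  shows "((\<lambda>t. x + t *\<^sub>R y) \<longlongrightarrow> x) (at (0::real))"
  using tendsto_add[OF tendsto_const tendsto_scaleR_lcs[OF tendsto_ident_at tendsto_const[of y]], of x 0]
  by simp

text \<open>Strict differentiability: both end points may move. It follows from the joint continuity
  of df by applying the mean value theorem on the segment from p s to q s, where all values of df
  are eventually close to df (x, y). The scale t is kept general because it is later taken to be s,
  s^2 or a difference of parameters.\<close>

lemma C1_with_strict:
  fixes f :: "'a::locally_convex_space \<Rightarrow> 'b::locally_convex_space"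
  assumes f: "C1_with U f df" and x: "x \<in> U"
    and p: "(p \<longlongrightarrow> x) F" and q: "(q \<longlongrightarrow> x) F"
    and t: "\<forall>\<^sub>F s in F. t s \<noteq> 0"
    and y: "((\<lambda>s. (1 / t s) *\<^sub>R (q s - p s)) \<longlongrightarrow> y) F"
  shows "((\<lambda>s. (1 / t s) *\<^sub>R (f (q s) - f (p s))) \<longlongrightarrow> df (x, y)) F"
proof -
  define Y where "Y s = (1 / t s) *\<^sub>R (q s - p s)" for s
  \<comment> \<open>The factor 1 / t s is built into h, so that \<open>h s 1 - h s 0\<close> is
    already the quotient in question.\<close>
  define h where "h s \<tau> = (1 / t s) *\<^sub>R f (p s + \<tau> *\<^sub>R (q s - p s))" for s and \<tau> :: real
  define h' where "h' s \<tau> = df (p s + \<tau> *\<^sub>R (q s - p s), Y s)" for s and \<tau> :: real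
  let ?F = "F \<times>\<^sub>F principal {0..1::real}"
  have fst: "filterlim fst F ?F" by (rule filterlim_fst)
  have pq: "((\<lambda>s. q s - p s) \<longlongrightarrow> 0) F" using tendsto_diff[OF q p] by simp
  have z: "((\<lambda>z. p (fst z) + snd z *\<^sub>R (q (fst z) - p (fst z))) \<longlongrightarrow> x) ?F"
    using tendsto_add[OF filterlim_compose[OF p fst] tendsto_bounded_scaleR[OF pq]] by simp
  have U: "\<forall>\<^sub>F z in ?F. p (fst z) + snd z *\<^sub>R (q (fst z) - p (fst z)) \<in> U"
    using topological_tendstoD[OF z C1_withD(1)[OF f] x] .
  have "((\<lambda>z. df (p (fst z) + snd z *\<^sub>R (q (fst z) - p (fst z)), Y (fst z))) \<longlongrightarrow> df (x, y)) ?F"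
  proof (rule continuous_on_tendsto_compose[OF C1_withD(3)[OF f]])
    show "((\<lambda>z. (p (fst z) + snd z *\<^sub>R (q (fst z) - p (fst z)), Y (fst z))) \<longlongrightarrow> (x, y)) ?F"
      using y unfolding Y_def[symmetric] by (intro tendsto_Pair z filterlim_compose[OF _ fst])
  qed (use x U in auto)
  then have L: "((\<lambda>z. h' (fst z) (snd z)) \<longlongrightarrow> df (x, y)) ?F" by (simp add: h'_def)
  have "\<forall>\<^sub>F s in F. \<forall>\<tau>\<in>{0..1}. p s + \<tau> *\<^sub>R (q s - p s) \<in> U"
    using U by (simp add: eventually_prod_principal)
  with t have lim: "\<forall>\<^sub>F s in F. \<forall>\<tau>\<in>{0..1}.
      ((\<lambda>\<epsilon>. (1 / \<epsilon>) *\<^sub>R (h s (\<tau> + \<epsilon>) - h s \<tau>)) \<longlongrightarrow> h' s \<tau>) (at 0)"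
  proof eventually_elim
    case (elim s)
    show ?case
    proof
      fix \<tau> :: real assume "\<tau> \<in> {0..1}"
      let ?z = "p s + \<tau> *\<^sub>R (q s - p s)"
      have "filterlim (\<lambda>\<epsilon>. \<epsilon> * t s) (at 0) (at 0)"
        using elim(1) by (auto simp: filterlim_at eventually_at_filter intro!: tendsto_eq_intros)
      from filterlim_compose[OF C1_withD(4)[OF f, of ?z "Y s"] this] elim(2) \<open>\<tau> \<in> {0..1}\<close>
      have "((\<lambda>\<epsilon>. (1 / (\<epsilon> * t s)) *\<^sub>R (f (?z + (\<epsilon> * t s) *\<^sub>R Y s) - f ?z)) \<longlongrightarrow> h' s \<tau>) (at 0)"
        by (simp add: h'_def)
      moreover have "?z + (\<epsilon> * t s) *\<^sub>R Y s = p s + (\<tau> + \<epsilon>) *\<^sub>R (q s - p s)" for \<epsilon>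
        using elim(1) by (simp add: Y_def algebra_simps)
      ultimately show "((\<lambda>\<epsilon>. (1 / \<epsilon>) *\<^sub>R (h s (\<tau> + \<epsilon>) - h s \<tau>)) \<longlongrightarrow> h' s \<tau>) (at 0)"
        by (simp add: h_def scaleR_diff_right[symmetric])
    qed
  qed
  from mean_value_tendsto[OF lim L] show ?thesis
    by (simp add: h_def scaleR_diff_right[symmetric])
qed

text \<open>The increment along y + z is split at the moving point x + t z; strict differentiability
  gives the limit of the part beyond that point.\<close>

lemma C1_with_add:
  assumes "C1_with U f df" "x \<in> U"
  shows "df (x, y + z) = df (x, y) + df (x, z)"
proof -
  have t0: "((\<lambda>t. x + t *\<^sub>R w) \<longlongrightarrow> x) (at (0::real))" for w
    by (rule tendsto_line)
  have ne: "\<forall>\<^sub>F t in at (0::real). t \<noteq> 0" by (simp add: eventually_at_filter)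
  have "((\<lambda>t. (1 / t) *\<^sub>R (f (x + t *\<^sub>R (y + z)) - f (x + t *\<^sub>R z))) \<longlongrightarrow> df (x, y)) (at 0)"
  proof (rule C1_with_strict[OF assms t0 t0 ne])
    show "((\<lambda>t. (1 / t) *\<^sub>R (x + t *\<^sub>R (y + z) - (x + t *\<^sub>R z))) \<longlongrightarrow> y) (at 0)"
      by (rule tendsto_eventually) (simp add: eventually_at_filter algebra_simps)
  qed
  from tendsto_add[OF this C1_withD(4)[OF assms, of z]]
  have "((\<lambda>t. (1 / t) *\<^sub>R (f (x + t *\<^sub>R (y + z)) - f x)) \<longlongrightarrow> df (x, y) + df (x, z)) (at 0)"
    by (simp add: scaleR_add_right[symmetric])
  from tendsto_unique[OF _ C1_withD(4)[OF assms] this] show ?thesis by simp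
qed

text \<open>The chain rule is strict differentiability of g, applied to the fixed point f x and the
  moving point f (x + t y).\<close>

lemma C1_with_compose:
  fixes f :: "'a::locally_convex_space \<Rightarrow> 'b::locally_convex_space"
    and g :: "'b \<Rightarrow> 'c::locally_convex_space"
  assumes f: "C1_with U f df" and g: "C1_with V g dg"
  shows "C1_with (U \<inter> f -` V) (g \<circ> f) (\<lambda>z. dg (f (fst z), df z))"
  unfolding C1_with_def
proof (intro conjI ballI allI)
  show "open (U \<inter> f -` V)"
    using C1_withD[OF f] C1_withD[OF g] by (intro continuous_open_preimage)
  show "continuous_on (U \<inter> f -` V) (g \<circ> f)"
    by (intro continuous_on_compose continuous_on_subset[OF C1_withD(2)[OF f]]
        continuous_on_subset[OF C1_withD(2)[OF g]]) auto
  show "continuous_on ((U \<inter> f -` V) \<times> UNIV) (\<lambda>z. dg (f (fst z), df z))"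
  proof (rule continuous_on_compose2[OF C1_withD(3)[OF g]])
    have "continuous_on ((U \<inter> f -` V) \<times> UNIV) (\<lambda>z. f (fst z))"
      by (rule continuous_on_compose2[OF C1_withD(2)[OF f] continuous_on_fst[OF continuous_on_id]]) auto
    moreover have "continuous_on ((U \<inter> f -` V) \<times> UNIV) df"
      by (rule continuous_on_subset[OF C1_withD(3)[OF f]]) auto
    ultimately show "continuous_on ((U \<inter> f -` V) \<times> UNIV) (\<lambda>z. (f (fst z), df z))"
      by (rule continuous_on_Pair)
  qed auto
  fix x y assume x: "x \<in> U \<inter> f -` V"
  have t0: "((\<lambda>t. x + t *\<^sub>R y) \<longlongrightarrow> x) (at (0::real))"
    by (rule tendsto_line)
  have fx: "((\<lambda>t. f (x + t *\<^sub>R y)) \<longlongrightarrow> f x) (at (0::real))"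
    using x C1_withD(1)[OF f]
    by (intro continuous_on_tendsto_compose[OF C1_withD(2)[OF f] t0] topological_tendstoD[OF t0]) auto
  show "((\<lambda>t. (1 / t) *\<^sub>R ((g \<circ> f) (x + t *\<^sub>R y) - (g \<circ> f) x)) \<longlongrightarrow> dg (f (fst (x, y)), df (x, y))) (at 0)"
    using C1_with_strict[OF g _ tendsto_const fx _ C1_withD(4)[OF f]] x
    by (simp add: eventually_at_filter)
qed

lemma C1_with_Pair:
  assumes f: "C1_with U f df" and g: "C1_with V g dg"
  shows "C1_with (U \<inter> V) (\<lambda>x. (f x, g x)) (\<lambda>z. (df z, dg z))"
  unfolding C1_with_def
proof (intro conjI ballI allI)
  show "open (U \<inter> V)" using C1_withD[OF f] C1_withD[OF g] by auto
  fix x y assume "x \<in> U \<inter> V"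
  then show "((\<lambda>t. (1 / t) *\<^sub>R ((f (x + t *\<^sub>R y), g (x + t *\<^sub>R y)) - (f x, g x))) \<longlongrightarrow> (df (x, y), dg (x, y))) (at 0)"
    using tendsto_Pair[OF C1_withD(4)[OF f] C1_withD(4)[OF g], of x x y y] by simp
qed (auto intro!: continuous_on_Pair continuous_on_subset[OF C1_withD(3)[OF f]] continuous_on_subset[OF C1_withD(2)[OF f]]
    continuous_on_subset[OF C1_withD(3)[OF g]] continuous_on_subset[OF C1_withD(2)[OF g]])

lemma C1_with_fst: "C1_with UNIV fst (\<lambda>z. fst (snd z))"
  unfolding C1_with_def
proof (intro conjI ballI allI)
  fix x y :: "'a \<times> 'b"
  have "\<forall>\<^sub>F t in at 0. (1 / t) *\<^sub>R (fst (x + t *\<^sub>R y) - fst x) = fst (snd (x, y))"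
    by (rule eventually_mono[OF eventually_neq_at_within[of 0]]) simp
  then show "((\<lambda>t. (1 / t) *\<^sub>R (fst (x + t *\<^sub>R y) - fst x)) \<longlongrightarrow> fst (snd (x, y))) (at 0)"
    by (rule tendsto_eventually)
qed (intro continuous_intros open_UNIV)+

lemma C1_with_snd: "C1_with UNIV snd (\<lambda>z. snd (snd z))"
  unfolding C1_with_def
proof (intro conjI ballI allI)
  fix x y :: "'a \<times> 'b"
  have "\<forall>\<^sub>F t in at 0. (1 / t) *\<^sub>R (snd (x + t *\<^sub>R y) - snd x) = snd (snd (x, y))"
    by (rule eventually_mono[OF eventually_neq_at_within[of 0]]) simp
  then show "((\<lambda>t. (1 / t) *\<^sub>R (snd (x + t *\<^sub>R y) - snd x)) \<longlongrightarrow> snd (snd (x, y))) (at 0)"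
    by (rule tendsto_eventually)
qed (intro continuous_intros open_UNIV)+

section \<open>Maps of class C^2 and second differences\<close>

text \<open>The second derivative is the derivative of df as a map on U \<times> E. Hence
  \<open>ddf ((x, u), (v, 0))\<close> is the usual d^2 f(x; u, v), while the last component would
  measure a change of the direction u.\<close>

definition C2_with where
  "C2_with U f df ddf \<longleftrightarrow> C1_with U f df \<and> C1_with (U \<times> UNIV) df ddf"

text \<open>Domain and derivatives are hidden, so that compositions in charts need no record of
  shrinking domains.\<close>

definition C2_at where
  "C2_at f x \<longleftrightarrow> (\<exists>U df ddf. x \<in> U \<and> C2_with U f df ddf)"

lemma C2_atI:
  "x \<in> U \<Longrightarrow> C1_with U f df \<Longrightarrow> C1_with (U \<times> UNIV) df ddf \<Longrightarrow> C2_at f x"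
  unfolding C2_at_def C2_with_def by blast

lemma C2_at_smooth_on:
  assumes "open U" "smooth_on U f" "x \<in> U"
  shows "C2_at f x"
proof -
  have "Ck_on (Suc (Suc 0)) U f" using assms by (simp add: smooth_on_def)
  then obtain df where df: "continuous_on U f"
    "\<forall>x\<in>U. \<forall>y. ((\<lambda>t. (1 / t) *\<^sub>R (f (x + t *\<^sub>R y) - f x)) \<longlongrightarrow> df (x, y)) (at 0)"
    "Ck_on (Suc 0) (U \<times> UNIV) df"
    unfolding Ck_on_Suc[of "Suc 0"] by blast
  moreover have "open (U \<times> (UNIV :: 'a set))" using assms by (intro open_Times) auto
  ultimately obtain ddf where "C1_with (U \<times> UNIV) df ddf" by (auto simp: Ck_on_1_iff)
  moreover have "continuous_on (U \<times> UNIV) df" using df(3) by (simp add: Ck_on_Suc)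
  ultimately show ?thesis
    using df(1,2) assms(1,3) by (intro C2_atI[of x U f df ddf]) (auto simp: C1_with_def[of U])
qed

text \<open>The derivative of the composite is dg after the pair of f \<circ> \<open>fst\<close> and
  df, hence a composite of C^1 maps, and the chain rule for C^1 applies once more.\<close>

lemma C2_at_compose:
  assumes "C2_at f x" "C2_at g (f x)"
  shows "C2_at (\<lambda>x. g (f x)) x"
proof -
  obtain U df ddf where f: "x \<in> U" "C1_with U f df" "C1_with (U \<times> UNIV) df ddf"
    using assms(1) by (auto simp: C2_at_def C2_with_def)
  obtain V dg ddg where g: "f x \<in> V" "C1_with V g dg" "C1_with (V \<times> UNIV) dg ddg"
    using assms(2) by (auto simp: C2_at_def C2_with_def)
  note 1 = C1_with_compose[OF f(2) g(2)]
  note 2 = C1_with_compose[OF C1_with_Pair[OF C1_with_compose[OF C1_with_fst f(2)] f(3)] g(3)]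
  have "(UNIV \<inter> fst -` U \<inter> U \<times> UNIV) \<inter> (\<lambda>x. ((f \<circ> fst) x, df x)) -` (V \<times> UNIV) = (U \<inter> f -` V) \<times> UNIV"
    by auto
  with 2 have "C1_with ((U \<inter> f -` V) \<times> UNIV) (\<lambda>z. dg (f (fst z), df z))
      (\<lambda>z. ddg (((f \<circ> fst) (fst z), df (fst z)), (df (fst (fst z), fst (snd z)), ddf z)))"
    by (simp add: comp_def)
  with 1 f(1) g(1) show ?thesis
    by (intro C2_atI[of x "U \<inter> f -` V" "\<lambda>x. g (f x)" "\<lambda>z. dg (f (fst z), df z)"])
      (auto simp: comp_def)
qed

lemma C2_at_Pair:
  assumes "C2_at f x" "C2_at g x"
  shows "C2_at (\<lambda>x. (f x, g x)) x"
proof -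
  obtain U df ddf where f: "x \<in> U" "C1_with U f df" "C1_with (U \<times> UNIV) df ddf"
    using assms(1) by (auto simp: C2_at_def C2_with_def)
  obtain V dg ddg where g: "x \<in> V" "C1_with V g dg" "C1_with (V \<times> UNIV) dg ddg"
    using assms(2) by (auto simp: C2_at_def C2_with_def)
  have *: "(U \<times> UNIV) \<inter> (V \<times> UNIV) = (U \<inter> V) \<times> UNIV" by auto
  have "x \<in> U \<inter> V" using f(1) g(1) by simp
  then show ?thesis
    by (rule C2_atI[OF _ C1_with_Pair[OF f(2) g(2)] C1_with_Pair[OF f(3) g(3), unfolded *]])
qed

lemma C2_at_fst: "C2_at fst x"
proof (rule C2_atI[OF UNIV_I C1_with_fst])
  show "C1_with (UNIV \<times> UNIV) (\<lambda>z. fst (snd z)) (\<lambda>z. fst (snd (snd z)))"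
    using C1_with_compose[OF C1_with_snd C1_with_fst] by (simp add: comp_def)
qed

lemma C2_at_snd: "C2_at snd x"
proof (rule C2_atI[OF UNIV_I C1_with_snd])
  show "C1_with (UNIV \<times> UNIV) (\<lambda>z. snd (snd z)) (\<lambda>z. snd (snd (snd z)))"
    using C1_with_compose[OF C1_with_snd C1_with_snd] by (simp add: comp_def)
qed

text \<open>The second difference is the increment, along a, of the function z \<mapsto> f (z + b) -
  f z. The derivative of that function in the direction a is a difference of values of df, and df is
  strictly differentiable. Of a and b only the first order behaviour enters.\<close>

lemma second_difference_tendsto:
  fixes f :: "'a::locally_convex_space \<Rightarrow> 'b::locally_convex_space"
  assumes f: "C2_with U f df ddf" and x: "x \<in> U"
    and a: "((\<lambda>s. (1 / t s) *\<^sub>R a s) \<longlongrightarrow> u) F" and b: "((\<lambda>s. (1 / t s) *\<^sub>R b s) \<longlongrightarrow> v) F"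
    and t: "\<forall>\<^sub>F s in F. t s \<noteq> 0" "(t \<longlongrightarrow> 0) F"
  shows "((\<lambda>s. (1 / (t s)\<^sup>2) *\<^sub>R (f (x + a s + b s) - f (x + a s) - f (x + b s) + f x)) \<longlongrightarrow>
    ddf ((x, u), (v, 0))) F"
proof -
  have null: "(w \<longlongrightarrow> 0) F" if "((\<lambda>s. (1 / t s) *\<^sub>R w s) \<longlongrightarrow> l) F" for w :: "_ \<Rightarrow> 'a" and l
    using tendsto_scaleR_lcs[OF t(2) that] t(1) by (auto elim!: Lim_transform_eventually eventually_mono)
  have f1: "C1_with U f df" and f2: "C1_with (U \<times> UNIV) df ddf" using f by (auto simp: C2_with_def)
  define h where "h s \<tau> = (1 / (t s)\<^sup>2) *\<^sub>R (f (x + \<tau> *\<^sub>R a s + b s) - f (x + \<tau> *\<^sub>R a s))" for s and \<tau> :: real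
  define h' where "h' s \<tau> = (1 / t s) *\<^sub>R
     (df (x + \<tau> *\<^sub>R a s + b s, (1 / t s) *\<^sub>R a s) - df (x + \<tau> *\<^sub>R a s, (1 / t s) *\<^sub>R a s))" for s and \<tau> :: real
  \<comment> \<open>The four values are regrouped: differences across b become differences along
    a.\<close>
  have four: "(1 / e) *\<^sub>R ((1 / r\<^sup>2) *\<^sub>R (A - B) - (1 / r\<^sup>2) *\<^sub>R (C - D)) =
      (1 / r) *\<^sub>R ((1 / (e * r)) *\<^sub>R (A - C) - (1 / (e * r)) *\<^sub>R (B - D))" for A B C D :: 'b and e r :: real
  proof -
    have "(1 / e) *\<^sub>R ((1 / r\<^sup>2) *\<^sub>R (A - B) - (1 / r\<^sup>2) *\<^sub>R (C - D)) = (1 / (e * r\<^sup>2)) *\<^sub>R ((A - B) - (C - D))"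
      by (simp add: scaleR_diff_right)
    also have "(A - B) - (C - D) = (A - C) - (B - D)" by simp
    finally show ?thesis by (simp add: scaleR_diff_right power2_eq_square mult_ac)
  qed
  let ?F = "F \<times>\<^sub>F principal {0..1::real}"
  have fst: "filterlim fst F ?F" by (rule filterlim_fst)
  have p: "((\<lambda>z. x + snd z *\<^sub>R a (fst z)) \<longlongrightarrow> x) ?F"
    using tendsto_add[OF tendsto_const tendsto_bounded_scaleR[OF null[OF a]]] by simp
  have q: "((\<lambda>z. x + snd z *\<^sub>R a (fst z) + b (fst z)) \<longlongrightarrow> x) ?F"
    using tendsto_add[OF p filterlim_compose[OF null[OF b] fst]] by simp
  \<comment> \<open>The two arguments of df differ by b in the base point and share their direction,
    whence the increment (v, 0).\<close>
  have L: "((\<lambda>z. h' (fst z) (snd z)) \<longlongrightarrow> ddf ((x, u), (v, 0))) ?F"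
    unfolding h'_def
  proof (rule C1_with_strict[OF f2])
    show "((\<lambda>z. (1 / t (fst z)) *\<^sub>R ((x + snd z *\<^sub>R a (fst z) + b (fst z), (1 / t (fst z)) *\<^sub>R a (fst z)) -
        (x + snd z *\<^sub>R a (fst z), (1 / t (fst z)) *\<^sub>R a (fst z)))) \<longlongrightarrow> (v, 0)) ?F"
      using tendsto_Pair[OF filterlim_compose[OF b fst] tendsto_const] by simp
    show "\<forall>\<^sub>F z in ?F. t (fst z) \<noteq> 0" using t(1) by (simp add: eventually_prod_principal)
  qed (use x in \<open>auto intro!: tendsto_Pair p q filterlim_compose[OF a fst]\<close>)
  have "\<forall>\<^sub>F s in F. \<forall>\<tau>\<in>{0..1}. x + \<tau> *\<^sub>R a s + b s \<in> U" "\<forall>\<^sub>F s in F. \<forall>\<tau>\<in>{0..1}. x + \<tau> *\<^sub>R a s \<in> U"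
    using topological_tendstoD[OF q C1_withD(1)[OF f1] x] topological_tendstoD[OF p C1_withD(1)[OF f1] x]
    by (simp_all add: eventually_prod_principal)
  with t(1) have lim: "\<forall>\<^sub>F s in F. \<forall>\<tau>\<in>{0..1}.
      ((\<lambda>\<epsilon>. (1 / \<epsilon>) *\<^sub>R (h s (\<tau> + \<epsilon>) - h s \<tau>)) \<longlongrightarrow> h' s \<tau>) (at 0)"
  proof eventually_elim
    case (elim s)
    show ?case
    proof
      fix \<tau> :: real assume \<tau>: "\<tau> \<in> {0..1}"
      let ?y = "(1 / t s) *\<^sub>R a s"
      have c: "filterlim (\<lambda>\<epsilon>. \<epsilon> * t s) (at 0) (at 0)"
        using elim(1) by (auto simp: filterlim_at eventually_at_filter intro!: tendsto_eq_intros)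
      have l: "((\<lambda>\<epsilon>. (1 / (\<epsilon> * t s)) *\<^sub>R (f (z + \<epsilon> *\<^sub>R a s) - f z)) \<longlongrightarrow> df (z, ?y)) (at 0)"
        if "z \<in> U" for z
        using filterlim_compose[OF C1_withD(4)[OF f1 that, of ?y] c] elim(1) by simp
      have "((\<lambda>\<epsilon>. (1 / t s) *\<^sub>R ((1 / (\<epsilon> * t s)) *\<^sub>R (f (x + \<tau> *\<^sub>R a s + b s + \<epsilon> *\<^sub>R a s) - f (x + \<tau> *\<^sub>R a s + b s)) -
         (1 / (\<epsilon> * t s)) *\<^sub>R (f (x + \<tau> *\<^sub>R a s + \<epsilon> *\<^sub>R a s) - f (x + \<tau> *\<^sub>R a s)))) \<longlongrightarrow> h' s \<tau>) (at 0)"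
        unfolding h'_def using elim \<tau> by (intro tendsto_scaleR_lcs[OF tendsto_const] tendsto_diff l) auto
      moreover have "(1 / \<epsilon>) *\<^sub>R (h s (\<tau> + \<epsilon>) - h s \<tau>) = (1 / t s) *\<^sub>R ((1 / (\<epsilon> * t s)) *\<^sub>R
          (f (x + \<tau> *\<^sub>R a s + b s + \<epsilon> *\<^sub>R a s) - f (x + \<tau> *\<^sub>R a s + b s)) -
         (1 / (\<epsilon> * t s)) *\<^sub>R (f (x + \<tau> *\<^sub>R a s + \<epsilon> *\<^sub>R a s) - f (x + \<tau> *\<^sub>R a s)))" for \<epsilon>
      proof -
        have "x + (\<tau> + \<epsilon>) *\<^sub>R a s = x + \<tau> *\<^sub>R a s + \<epsilon> *\<^sub>R a s"
          "x + \<tau> *\<^sub>R a s + \<epsilon> *\<^sub>R a s + b s = x + \<tau> *\<^sub>R a s + b s + \<epsilon> *\<^sub>R a s"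
          by (simp_all add: scaleR_add_left add.assoc add.commute[of "b s"])
        then show ?thesis unfolding h_def by (simp only: four)
      qed
      ultimately show "((\<lambda>\<epsilon>. (1 / \<epsilon>) *\<^sub>R (h s (\<tau> + \<epsilon>) - h s \<tau>)) \<longlongrightarrow> h' s \<tau>) (at 0)"
        by simp
    qed
  qed
  have "h s 1 - h s 0 = (1 / (t s)\<^sup>2) *\<^sub>R (f (x + a s + b s) - f (x + a s) - f (x + b s) + f x)" for s
    by (simp add: h_def scaleR_diff_right scaleR_add_right)
  with mean_value_tendsto[OF lim L] show ?thesis by simp
qed

text \<open>The second difference is symmetric in its two increments, so both mixed derivatives are
  limits of the same expression.\<close>

lemma C2_with_symmetric:
  assumes "C2_with U f df ddf" "x \<in> U"
  shows "ddf ((x, u), (v, 0)) = ddf ((x, v), (u, 0))"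
proof -
  have ne: "\<forall>\<^sub>F t in at (0::real). t \<noteq> 0" by (simp add: eventually_at_filter)
  have i: "((\<lambda>s. (1 / s) *\<^sub>R (s *\<^sub>R w)) \<longlongrightarrow> w) (at (0::real))" for w :: 'a
    by (rule tendsto_eventually, rule eventually_mono[OF ne]) simp
  from second_difference_tendsto[OF assms i[of u] i[of v] ne]
  have "((\<lambda>s. (1 / s\<^sup>2) *\<^sub>R (f (x + s *\<^sub>R u + s *\<^sub>R v) - f (x + s *\<^sub>R u) - f (x + s *\<^sub>R v) + f x)) \<longlongrightarrow>
    ddf ((x, u), (v, 0))) (at 0)" by simp
  moreover from second_difference_tendsto[OF assms i[of v] i[of u] ne]
  have "((\<lambda>s. (1 / s\<^sup>2) *\<^sub>R (f (x + s *\<^sub>R u + s *\<^sub>R v) - f (x + s *\<^sub>R u) - f (x + s *\<^sub>R v) + f x)) \<longlongrightarrow>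
    ddf ((x, v), (u, 0))) (at 0)" by (simp add: algebra_simps)
  ultimately show ?thesis by (intro tendsto_unique[of "at (0::real)"]) auto
qed

lemma C1_with_cong:
  assumes f: "C1_with U f df" and V: "open V" "V \<subseteq> U" "\<And>x. x \<in> V \<Longrightarrow> f x = g x"
  shows "C1_with V g df"
  unfolding C1_with_def
proof (intro conjI ballI allI)
  show "continuous_on V g"
    using continuous_on_subset[OF C1_withD(2)[OF f] V(2)] V(3) continuous_on_cong by metis
  show "continuous_on (V \<times> UNIV) df"
    using V(2) by (intro continuous_on_subset[OF C1_withD(3)[OF f]]) auto
  fix x y assume x: "x \<in> V"
  have t0: "((\<lambda>t. x + t *\<^sub>R y) \<longlongrightarrow> x) (at (0::real))"
    by (rule tendsto_line)
  have "\<forall>\<^sub>F t in at 0. (1 / t) *\<^sub>R (f (x + t *\<^sub>R y) - f x) = (1 / t) *\<^sub>R (g (x + t *\<^sub>R y) - g x)"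
    using topological_tendstoD[OF t0 V(1) x] by eventually_elim (simp add: V(3) x)
  moreover have "((\<lambda>t. (1 / t) *\<^sub>R (f (x + t *\<^sub>R y) - f x)) \<longlongrightarrow> df (x, y)) (at 0)"
    using C1_withD(4)[OF f] x V(2) by auto
  ultimately show "((\<lambda>t. (1 / t) *\<^sub>R (g (x + t *\<^sub>R y) - g x)) \<longlongrightarrow> df (x, y)) (at 0)"
    by (rule Lim_transform_eventually[rotated])
qed (rule V)

lemma C2_at_cong:
  assumes "C2_at f x" "\<forall>\<^sub>F z in nhds x. f z = g z"
  shows "C2_at g x"
proof -
  obtain U df ddf where f: "x \<in> U" "C1_with U f df" "C1_with (U \<times> UNIV) df ddf"
    using assms(1) by (auto simp: C2_at_def C2_with_def)
  obtain S where S: "open S" "x \<in> S" "\<And>z. z \<in> S \<Longrightarrow> f z = g z"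
    using assms(2) by (auto simp: eventually_nhds)
  have o: "open (U \<inter> S)" using C1_withD(1)[OF f(2)] S(1) by blast
  show ?thesis
  proof (rule C2_atI)
    show "x \<in> U \<inter> S" using f(1) S(2) by simp
    show "C1_with (U \<inter> S) g df" by (rule C1_with_cong[OF f(2) o]) (use S(3) in auto)
    show "C1_with ((U \<inter> S) \<times> UNIV) df ddf"
      by (rule C1_with_cong[OF f(3)]) (use o in \<open>auto intro: open_Times\<close>)
  qed
qed

lemma C1_with_curve:
  fixes x :: "real \<Rightarrow> 'a::locally_convex_space"
  assumes g: "C1_with W g dg" "x t \<in> W"
    and x: "(x \<longlongrightarrow> x t) (at t within I)"
      "((\<lambda>s. (1 / (s - t)) *\<^sub>R (x s - x t)) \<longlongrightarrow> d) (at t within I)"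
  shows "((\<lambda>s. (1 / (s - t)) *\<^sub>R (g (x s) - g (x t))) \<longlongrightarrow> dg (x t, d)) (at t within I)"
  by (rule C1_with_strict[OF g tendsto_const x(1) _ x(2)])
    (use eventually_neq_at_within[of t t I] in \<open>auto elim: eventually_mono\<close>)

section \<open>Charts and curves\<close>

definition chart_on :: "'m topology \<Rightarrow> ('m, 'e::locally_convex_space) chart \<Rightarrow> bool" where
  "chart_on T c \<longleftrightarrow> openin T (fst c) \<and> open (snd c ` fst c) \<and>
     homeomorphic_map (subtopology T (fst c)) (top_of_set (snd c ` fst c)) (snd c)"

lemma manifold_chart_on: "manifold T A \<Longrightarrow> c \<in> A \<Longrightarrow> chart_on T c"
  by (auto simp: manifold_def chart_on_def)

lemma chart_on_inj:
  assumes "chart_on T c"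
  shows "inj_on (snd c) (fst c)"
proof -
  have "topspace (subtopology T (fst c)) = fst c"
    using assms openin_subset by (auto simp: chart_on_def)
  then show ?thesis
    using assms homeomorphic_imp_injective_map unfolding chart_on_def by metis
qed

lemma chart_on_inv [simp]: "chart_on T c \<Longrightarrow> p \<in> fst c \<Longrightarrow> chart_inv c (snd c p) = p"
  by (simp add: chart_on_inj)

lemma chart_on_open_image:
  assumes c: "chart_on T c" and W: "openin T W"
  shows "open (snd c ` (fst c \<inter> W))"
proof -
  have "openin (subtopology T (fst c)) (fst c \<inter> W)"
    using W by (auto simp: openin_subtopology)
  then have "openin (top_of_set (snd c ` fst c)) (snd c ` (fst c \<inter> W))"
    using c homeomorphic_imp_open_map unfolding chart_on_def open_map_def by blast
  then show ?thesis using c openin_open_trans unfolding chart_on_def by blast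
qed

lemma chart_on_eventually:
  assumes c: "chart_on T c" and W: "openin T W" and p: "p \<in> fst c" "p \<in> W"
  shows "\<forall>\<^sub>F z in nhds (snd c p). z \<in> snd c ` fst c \<and> chart_inv c z \<in> fst c \<and> chart_inv c z \<in> W"
proof -
  have "\<forall>\<^sub>F z in nhds (snd c p). z \<in> snd c ` (fst c \<inter> W)"
    using chart_on_open_image[OF c W] p by (intro eventually_nhds_in_open) auto
  then show ?thesis by eventually_elim (use c in auto)
qed

lemma chart_on_prod:
  assumes c: "chart_on T c" and d: "chart_on T' d"
  shows "chart_on (prod_topology T T') (fst c \<times> fst d, map_prod (snd c) (snd d))"
proof -
  have im: "map_prod (snd c) (snd d) ` (fst c \<times> fst d) = (snd c ` fst c) \<times> (snd d ` fst d)"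
    by auto
  obtain f where f: "homeomorphic_maps (subtopology T (fst c)) (top_of_set (snd c ` fst c)) (snd c) f"
    using c by (auto simp: chart_on_def homeomorphic_map_maps)
  obtain g where g: "homeomorphic_maps (subtopology T' (fst d)) (top_of_set (snd d ` fst d)) (snd d) g"
    using d by (auto simp: chart_on_def homeomorphic_map_maps)
  have "homeomorphic_maps (prod_topology (subtopology T (fst c)) (subtopology T' (fst d)))
      (prod_topology (top_of_set (snd c ` fst c)) (top_of_set (snd d ` fst d)))
      (\<lambda>(x, y). (snd c x, snd d y)) (\<lambda>(x, y). (f x, g y))"
    using f g homeomorphic_maps_prod by blast
  then have "homeomorphic_map (prod_topology (subtopology T (fst c)) (subtopology T' (fst d)))
      (prod_topology (top_of_set (snd c ` fst c)) (top_of_set (snd d ` fst d)))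
      (map_prod (snd c) (snd d))"
    by (auto simp: homeomorphic_map_maps map_prod_def)
  then show ?thesis
    using c d unfolding chart_on_def
    by (simp add: im open_Times openin_prod_Times_iff subtopology_Times[symmetric] prod_topology_euclidean)
qed

lemma chart_inv_prod:
  assumes "chart_on T c" "chart_on T' d" "x \<in> snd c ` fst c" "y \<in> snd d ` fst d"
  shows "inv_into (fst c \<times> fst d) (map_prod (snd c) (snd d)) (x, y) = (chart_inv c x, chart_inv d y)"
proof (rule inv_into_f_eq)
  show "inj_on (map_prod (snd c) (snd d)) (fst c \<times> fst d)"
    using assms(1,2) by (intro map_prod_inj_on chart_on_inj)
  show "(chart_inv c x, chart_inv d y) \<in> fst c \<times> fst d"
    using assms by (auto intro: inv_into_into)
  show "map_prod (snd c) (snd d) (chart_inv c x, chart_inv d y) = (x, y)"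
    using assms by (auto simp: f_inv_into_f)
qed

lemma smooth_mapD:
  assumes "smooth_map T A T' A' f" "c \<in> A" "d \<in> A'"
  shows "smooth_on (snd c ` (fst c \<inter> f -` fst d)) (snd d \<circ> f \<circ> chart_inv c)"
  using assms by (auto simp: smooth_map_def split_beta)

lemma smooth_map_chart_open:
  assumes f: "smooth_map T A T' A' f" and c: "chart_on T c" and d: "openin T' (fst d)"
  shows "open (snd c ` (fst c \<inter> f -` fst d))"
proof -
  have "openin T {x \<in> topspace T. f x \<in> fst d}"
    using f d by (intro openin_continuous_map_preimage) (auto simp: smooth_map_def)
  from chart_on_open_image[OF c this]
  have "open (snd c ` (fst c \<inter> {x \<in> topspace T. f x \<in> fst d}))" .
  moreover have "fst c \<inter> {x \<in> topspace T. f x \<in> fst d} = fst c \<inter> f -` fst d"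
    using c openin_subset by (auto simp: chart_on_def)
  ultimately show ?thesis by simp
qed

lemma smooth_map_C2_at:
  assumes f: "smooth_map T A T' A' f" and c: "c \<in> A" "chart_on T c" and d: "d \<in> A'" "openin T' (fst d)"
    and p: "p \<in> fst c" "f p \<in> fst d"
  shows "C2_at (\<lambda>z. snd d (f (chart_inv c z))) (snd c p)"
proof -
  have "smooth_on (snd c ` (fst c \<inter> f -` fst d)) (snd d \<circ> f \<circ> chart_inv c)"
    by (rule smooth_mapD[OF f c(1) d(1)])
  from C2_at_smooth_on[OF smooth_map_chart_open[OF f c(2) d(2)] this, of "snd c p"] p
  show ?thesis by (simp add: comp_def)
qed

text \<open>The inverse of a product chart is a single \<open>inv_into\<close>, which splits into
  components only on the image of the chart. That image is open, so the two expressions agree near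
  the point.\<close>

lemma smooth_map_prod_C2_at:
  assumes f: "smooth_map (prod_topology T1 T2) (prod_atlas A1 A2) T' A' f"
    and c: "c \<in> A1" "chart_on T1 c" "c' \<in> A2" "chart_on T2 c'"
    and d: "d \<in> A'" "openin T' (fst d)" and p: "p \<in> fst c" "q \<in> fst c'" "f (p, q) \<in> fst d"
  shows "C2_at (\<lambda>z. snd d (f (chart_inv c (fst z), chart_inv c' (snd z)))) (snd c p, snd c' q)"
proof -
  let ?c = "(fst c \<times> fst c', map_prod (snd c) (snd c'))"
  have "?c \<in> prod_atlas A1 A2" using c by (cases c; cases c') (auto simp: prod_atlas_def)
  from smooth_map_C2_at[OF f this chart_on_prod[OF c(2,4)] d, of "(p, q)"] p
  have *: "C2_at (\<lambda>z. snd d (f (inv_into (fst c \<times> fst c') (map_prod (snd c) (snd c')) z))) (snd c p, snd c' q)"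
    by simp
  show ?thesis
  proof (rule C2_at_cong[OF *])
    have "open (snd c ` fst c \<times> snd c' ` fst c')" using c by (auto simp: chart_on_def intro: open_Times)
    then have "\<forall>\<^sub>F z in nhds (snd c p, snd c' q). z \<in> snd c ` fst c \<times> snd c' ` fst c'"
      using p by (intro eventually_nhds_in_open) auto
    then show "\<forall>\<^sub>F z in nhds (snd c p, snd c' q).
        snd d (f (inv_into (fst c \<times> fst c') (map_prod (snd c) (snd c')) z)) =
        snd d (f (chart_inv c (fst z), chart_inv c' (snd z)))"
      by eventually_elim (use chart_inv_prod[OF c(2,4)] in auto)
  qed
qed

section \<open>Curves of class C^1\<close>

lemma at_within_Icc_nontrivial [simp]: "t \<in> {0..1::real} \<Longrightarrow> at t within {0..1} \<noteq> bot"
  using connected_imp_perfect[of "{0..1::real}" t]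
  by (metis all_not_in_conv atLeastAtMost_singleton_iff connected_Icc trivial_limit_within zero_neq_one)

lemma curve_eventually:
  assumes "continuous_map (top_of_set I) T \<gamma>" "openin T W" "t \<in> I" "\<gamma> t \<in> W"
  shows "\<forall>\<^sub>F s in at t within I. \<gamma> s \<in> W"
proof -
  have "openin (top_of_set I) {s \<in> topspace (top_of_set I). \<gamma> s \<in> W}"
    using assms by (intro openin_continuous_map_preimage) auto
  then obtain O' where "open O'" "{s \<in> I. \<gamma> s \<in> W} = I \<inter> O'"
    by (auto simp: openin_open)
  then show ?thesis using assms(3,4) unfolding eventually_at_topological by blast
qed

lemma curve_chart_tendsto:
  assumes \<gamma>: "continuous_map (top_of_set I) T \<gamma>" and c: "chart_on T c" and t: "t \<in> I" "\<gamma> t \<in> fst c"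
  shows "((\<lambda>s. snd c (\<gamma> s)) \<longlongrightarrow> snd c (\<gamma> t)) (at t within I)"
proof (rule topological_tendstoI)
  fix S assume S: "open S" "snd c (\<gamma> t) \<in> S"
  have "continuous_map (subtopology T (fst c)) euclidean (snd c)"
    using c continuous_map_in_subtopology homeomorphic_imp_continuous_map unfolding chart_on_def by blast
  then have "openin (subtopology T (fst c)) {x \<in> topspace (subtopology T (fst c)). snd c x \<in> S}"
    using S(1) by (intro openin_continuous_map_preimage) auto
  then have "openin T {x \<in> topspace (subtopology T (fst c)). snd c x \<in> S}"
    using c openin_trans_full unfolding chart_on_def by blast
  then have "\<forall>\<^sub>F s in at t within I. \<gamma> s \<in> {x \<in> topspace (subtopology T (fst c)). snd c x \<in> S}"
    by (rule curve_eventually[OF \<gamma>]) (use t S c openin_subset in \<open>auto simp: chart_on_def\<close>)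
  then show "\<forall>\<^sub>F s in at t within I. snd c (\<gamma> s) \<in> S" by eventually_elim auto
qed

text \<open>This is the condition of \<open>C1_curve\<close> for one chart with the velocity named,
  because the velocity near 0 has to be analysed later.\<close>

definition curve_deriv ::
  "('m, 'e::locally_convex_space) chart \<Rightarrow> (real \<Rightarrow> 'm) \<Rightarrow> (real \<Rightarrow> 'e) \<Rightarrow> bool" where
  "curve_deriv c \<gamma> \<delta> \<longleftrightarrow>
     (\<forall>t\<in>{0..1} \<inter> \<gamma> -` fst c.
       ((\<lambda>s. (1 / (s - t)) *\<^sub>R (snd c (\<gamma> s) - snd c (\<gamma> t))) \<longlongrightarrow> \<delta> t) (at t within {0..1})) \<and>
     continuous_on ({0..1} \<inter> \<gamma> -` fst c) \<delta>"

lemma curve_derivD: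
  assumes "curve_deriv c \<gamma> \<delta>"
  shows "t \<in> {0..1} \<Longrightarrow> \<gamma> t \<in> fst c \<Longrightarrow>
      ((\<lambda>s. (1 / (s - t)) *\<^sub>R (snd c (\<gamma> s) - snd c (\<gamma> t))) \<longlongrightarrow> \<delta> t) (at t within {0..1})"
    "continuous_on ({0..1} \<inter> \<gamma> -` fst c) \<delta>"
  using assms by (auto simp: curve_deriv_def)

lemma C1_curve_iff:
  "C1_curve T A \<gamma> \<longleftrightarrow>
     continuous_map (top_of_set {0..1}) T \<gamma> \<and> (\<forall>c\<in>A. \<exists>\<delta>. curve_deriv c \<gamma> \<delta>)"
  by (simp add: C1_curve_def curve_deriv_def split_beta)

lemma C1_curve_pair:
  assumes \<gamma>: "C1_curve T A \<gamma>" and \<eta>: "C1_curve T' A' \<eta>"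
  shows "C1_curve (prod_topology T T') (prod_atlas A A') (\<lambda>t. (\<gamma> t, \<eta> t))"
  unfolding C1_curve_iff
proof (intro conjI ballI)
  show "continuous_map (top_of_set {0..1}) (prod_topology T T') (\<lambda>t. (\<gamma> t, \<eta> t))"
    using assms by (intro continuous_map_pairedI) (auto simp: C1_curve_def)
  fix e assume "e \<in> prod_atlas A A'"
  then obtain c d where cd: "c \<in> A" "d \<in> A'" "e = (fst c \<times> fst d, map_prod (snd c) (snd d))"
    by (force simp: prod_atlas_def)
  obtain \<delta> where "curve_deriv c \<gamma> \<delta>"
    using \<gamma> cd(1) by (auto simp: C1_curve_iff)
  note \<delta> = curve_derivD[OF this]
  obtain \<epsilon> where "curve_deriv d \<eta> \<epsilon>"
    using \<eta> cd(2) by (auto simp: C1_curve_iff)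
  note \<epsilon> = curve_derivD[OF this]
  let ?S = "{0..1} \<inter> (\<lambda>t. (\<gamma> t, \<eta> t)) -` fst e"
  have "((\<lambda>s. (1 / (s - t)) *\<^sub>R (snd e (\<gamma> s, \<eta> s) - snd e (\<gamma> t, \<eta> t))) \<longlongrightarrow> (\<delta> t, \<epsilon> t)) (at t within {0..1})"
    if "t \<in> ?S" for t
    using tendsto_Pair[OF \<delta>(1)[of t] \<epsilon>(1)[of t]] that cd(3) by simp
  moreover have "continuous_on ?S (\<lambda>t. (\<delta> t, \<epsilon> t))"
    using cd(3) by (intro continuous_on_Pair continuous_on_subset[OF \<delta>(2)] continuous_on_subset[OF \<epsilon>(2)]) auto
  ultimately have "curve_deriv e (\<lambda>t. (\<gamma> t, \<eta> t)) (\<lambda>t. (\<delta> t, \<epsilon> t))"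
    by (simp add: curve_deriv_def)
  then show "\<exists>\<delta>. curve_deriv e (\<lambda>t. (\<gamma> t, \<eta> t)) \<delta>" by (rule exI[where x = "\<lambda>t. (\<delta> t, \<epsilon> t)"])
qed

text \<open>Locally this is the chain rule in a chart c around \<gamma> t. The work lies in gluing,
  since c changes with t while one velocity function is required for each chart d of the
  target.\<close>

lemma C1_curve_smooth_map:
  assumes f: "smooth_map T A T' A' f" and T: "\<And>c. c \<in> A \<Longrightarrow> chart_on T c" "\<Union> (fst ` A) = topspace T"
    and T': "\<And>c. c \<in> A' \<Longrightarrow> openin T' (fst c)" and \<gamma>: "C1_curve T A \<gamma>"
  shows "C1_curve T' A' (\<lambda>t. f (\<gamma> t))"
  unfolding C1_curve_iff
proof (intro conjI ballI)
  let ?I = "{0..1::real}"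
  have c\<gamma>: "continuous_map (top_of_set ?I) T \<gamma>" using \<gamma> by (simp add: C1_curve_def)
  have cf: "continuous_map T T' f" using f by (simp add: smooth_map_def)
  show "continuous_map (top_of_set ?I) T' (\<lambda>t. f (\<gamma> t))"
    using continuous_map_compose[OF c\<gamma> cf] by (simp add: comp_def)
  fix d assume d: "d \<in> A'"
  let ?Q = "\<lambda>t s. (1 / (s - t)) *\<^sub>R (snd d (f (\<gamma> s)) - snd d (f (\<gamma> t)))"
  let ?S = "?I \<inter> (\<lambda>t. f (\<gamma> t)) -` fst d"
  \<comment> \<open>Defined as a limit, \<delta>' does not depend on c; uniqueness of limits
    identifies it with each local formula.\<close>
  define \<delta>' where "\<delta>' t = Lim (at t within ?I) (?Q t)" for t
  have "(?Q t \<longlongrightarrow> \<delta>' t) (at t within ?I) \<and> (\<delta>' \<longlongrightarrow> \<delta>' t) (at t within ?S)" if t: "t \<in> ?S" for t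
  proof -
    have "\<gamma> t \<in> topspace T" using c\<gamma> t by (auto simp: continuous_map_def)
    then obtain c where c: "c \<in> A" "\<gamma> t \<in> fst c" unfolding T(2)[symmetric] by blast
    note cc = T(1)[OF c(1)]
    obtain \<delta> where "curve_deriv c \<gamma> \<delta>"
      using \<gamma> c(1) by (auto simp: C1_curve_iff)
    note \<delta> = curve_derivD[OF this]
    let ?W = "snd c ` (fst c \<inter> f -` fst d)"
    have "smooth_on ?W (snd d \<circ> f \<circ> chart_inv c)"
      by (rule smooth_mapD[OF f c(1) d])
    then obtain dg where dg: "C1_with ?W (snd d \<circ> f \<circ> chart_inv c) dg"
      using Ck_on_1_iff[OF smooth_map_chart_open[OF f cc T'[OF d]]] unfolding smooth_on_def by blast
    define P where "P = {x \<in> topspace T. f x \<in> fst d} \<inter> fst c"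
    have P: "openin T P"
      unfolding P_def using cc T'[OF d] cf
      by (intro openin_Int openin_continuous_map_preimage) (auto simp: chart_on_def)
    have "openin (top_of_set ?I) {s \<in> topspace (top_of_set ?I). \<gamma> s \<in> P}"
      by (rule openin_continuous_map_preimage[OF c\<gamma> P])
    then obtain O' where O': "open O'" "{s \<in> ?I. \<gamma> s \<in> P} = ?I \<inter> O'"
      by (auto simp: openin_open)
    let ?J = "{s \<in> ?I. \<gamma> s \<in> P}"
    have PD: "\<gamma> s \<in> fst c" "f (\<gamma> s) \<in> fst d" "snd c (\<gamma> s) \<in> ?W" if "s \<in> ?J" for s
      using that by (auto simp: P_def)
    have tJ: "t \<in> ?J" using t c(2) \<open>\<gamma> t \<in> topspace T\<close> by (simp add: P_def)
    have Q: "(?Q r \<longlongrightarrow> dg (snd c (\<gamma> r), \<delta> r)) (at r within ?I)" if r: "r \<in> ?J" for r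
    proof -
      have rI: "r \<in> ?I" using r by simp
      have "((\<lambda>s. (1 / (s - r)) *\<^sub>R ((snd d \<circ> f \<circ> chart_inv c) (snd c (\<gamma> s)) -
          (snd d \<circ> f \<circ> chart_inv c) (snd c (\<gamma> r)))) \<longlongrightarrow> dg (snd c (\<gamma> r), \<delta> r)) (at r within ?I)"
        by (rule C1_with_curve[OF dg PD(3)[OF r] curve_chart_tendsto[OF c\<gamma> cc rI PD(1)[OF r]] \<delta>(1)[OF rI PD(1)[OF r]]])
      moreover have "\<forall>\<^sub>F s in at r within ?I. \<gamma> s \<in> P"
        using r by (intro curve_eventually[OF c\<gamma> P]) auto
      then have "\<forall>\<^sub>F s in at r within ?I. (1 / (s - r)) *\<^sub>R ((snd d \<circ> f \<circ> chart_inv c) (snd c (\<gamma> s)) -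
          (snd d \<circ> f \<circ> chart_inv c) (snd c (\<gamma> r))) = ?Q r s"
        by eventually_elim (use PD(1)[OF r] cc in \<open>simp add: P_def\<close>)
      ultimately show ?thesis by (rule Lim_transform_eventually)
    qed
    have \<delta>': "\<delta>' r = dg (snd c (\<gamma> r), \<delta> r)" if "r \<in> ?J" for r
      unfolding \<delta>'_def using that by (intro tendsto_Lim Q) auto
    have "continuous_on ?J (\<lambda>s. snd c (\<gamma> s))"
      unfolding continuous_on_def
    proof
      fix r assume r: "r \<in> ?J"
      have "((\<lambda>s. snd c (\<gamma> s)) \<longlongrightarrow> snd c (\<gamma> r)) (at r within ?I)"
        using r PD by (intro curve_chart_tendsto[OF c\<gamma> cc]) auto
      then show "((\<lambda>s. snd c (\<gamma> s)) \<longlongrightarrow> snd c (\<gamma> r)) (at r within ?J)"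
        by (rule tendsto_within_subset) auto
    qed
    then have "continuous_on ?J (\<lambda>s. dg (snd c (\<gamma> s), \<delta> s))"
      using PD by (intro continuous_on_compose2[OF C1_withD(3)[OF dg]] continuous_on_Pair
          continuous_on_subset[OF \<delta>(2)]) auto
    then have "continuous_on ?J \<delta>'"
      using \<delta>' continuous_on_cong by (metis (no_types, lifting))
    then have "(\<delta>' \<longlongrightarrow> \<delta>' t) (at t within ?J)" using tJ by (simp add: continuous_on_def)
    \<comment> \<open>\<open>?J\<close> is the trace of O' on [0, 1] and is contained in
      \<open>?S\<close>, so both sets agree within O'.\<close>
    moreover have "at t within ?J = at t within ?S"
    proof (rule at_within_nhd[of t O'])
      have "?J \<subseteq> ?S" by (auto simp: P_def)
      then show "?J \<inter> O' - {t} = ?S \<inter> O' - {t}" using O'(2) by blast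
    qed (use O' tJ in auto)
    ultimately show ?thesis using Q[OF tJ] \<delta>'[OF tJ] by simp
  qed
  then have "curve_deriv d (\<lambda>t. f (\<gamma> t)) \<delta>'"
    unfolding curve_deriv_def continuous_on_def by blast
  then show "\<exists>\<delta>. curve_deriv d (\<lambda>t. f (\<gamma> t)) \<delta>" by (rule exI[where x = \<delta>'])
qed

lemma C2_at_tendsto:
  assumes "C2_at f x"
  shows "(f \<longlongrightarrow> f x) (nhds x)"
proof -
  obtain U df where f: "x \<in> U" "C1_with U f df"
    using assms by (auto simp: C2_at_def C2_with_def)
  then have "isCont f x"
    using C1_withD(1,2)[OF f(2)] continuous_on_eq_continuous_at by blast
  then show ?thesis by (simp add: isCont_def tendsto_at_iff_tendsto_nhds)
qed

lemma curve_deriv_tendsto: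
  assumes \<gamma>: "continuous_map (top_of_set {0..1}) T \<gamma>" and c: "chart_on T c"
    and \<delta>: "curve_deriv c \<gamma> \<delta>" and t: "t \<in> {0..1}" "\<gamma> t \<in> fst c"
  shows "(\<delta> \<longlongrightarrow> \<delta> t) (at t within {0..1})"
proof (rule continuous_on_tendsto_compose[OF curve_derivD(2)[OF \<delta>] tendsto_ident_at])
  have "\<forall>\<^sub>F s in at t within {0..1}. \<gamma> s \<in> fst c"
    by (rule curve_eventually[OF \<gamma>]) (use t c in \<open>auto simp: chart_on_def\<close>)
  moreover have "\<forall>\<^sub>F s in at t within {0..1}. s \<in> {0..1}"
    by (simp add: eventually_at_filter)
  ultimately show "\<forall>\<^sub>F s in at t within {0..1}. s \<in> {0..1} \<inter> \<gamma> -` fst c"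
    by eventually_elim simp
qed (use t in simp)

section \<open>Commutators of curves in a Lie group\<close>

definition commutator :: "('g, 'b) monoid_scheme \<Rightarrow> 'g \<Rightarrow> 'g \<Rightarrow> 'g" where
  "commutator G x y = x \<otimes>\<^bsub>G\<^esub> y \<otimes>\<^bsub>G\<^esub> inv\<^bsub>G\<^esub> x \<otimes>\<^bsub>G\<^esub> inv\<^bsub>G\<^esub> y"

lemma (in group) commutator_one [simp]:
  assumes "x \<in> carrier G"
  shows "commutator G x \<one> = \<one>" "commutator G \<one> x = \<one>"
  using assms by (simp_all add: commutator_def)

text \<open>This identity allows the limit of the commutator to be found from the two products
  alone, without expanding the inverses.\<close>

lemma (in group) commutator_mult:
  assumes "x \<in> carrier G" "y \<in> carrier G"
  shows "commutator G x y \<otimes> (y \<otimes> x) = x \<otimes> y"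
proof -
  have "inv y \<otimes> (y \<otimes> x) = x" using assms by (simp add: m_assoc[symmetric])
  then show ?thesis using assms by (simp add: commutator_def m_assoc)
qed

lemma C2_at_eventually:
  "C2_at f x \<Longrightarrow> \<forall>\<^sub>F z in nhds (f x). P z \<Longrightarrow> \<forall>\<^sub>F z in nhds x. P (f z)"
  by (rule eventually_compose_filterlim[OF _ C2_at_tendsto])

text \<open>A chart has arbitrary values outside its domain, so regularity of the coordinates of k
  is meaningful only while k stays in the domain. Both conditions are carried along
  together.\<close>

definition C2_into :: "('g, 'e::locally_convex_space) chart \<Rightarrow> ('a::locally_convex_space \<Rightarrow> 'g) \<Rightarrow> 'a \<Rightarrow> bool" where
  "C2_into c k x \<longleftrightarrow> (\<forall>\<^sub>F z in nhds x. k z \<in> fst c) \<and> C2_at (\<lambda>z. snd c (k z)) x"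

context
  fixes G :: "('g, 'e::locally_convex_space) lie_structure" (structure)
  assumes lie: "lie_group G"
begin

interpretation group G
  using lie by (simp add: lie_group_def)

lemma topspace_eq: "topspace (gtop G) = carrier G"
  using lie by (simp add: lie_group_def)

lemma atlas_chart_on: "c \<in> gatlas G \<Longrightarrow> chart_on (gtop G) c"
  using lie manifold_chart_on unfolding lie_group_def by blast

lemma chart_inv_chart [simp]: "c \<in> gatlas G \<Longrightarrow> p \<in> fst c \<Longrightarrow> chart_inv c (snd c p) = p"
  using atlas_chart_on by (rule chart_on_inv)

lemma atlas_openin: "c \<in> gatlas G \<Longrightarrow> openin (gtop G) (fst c)"
  using atlas_chart_on by (auto simp: chart_on_def)

lemma atlas_carrier: "c \<in> gatlas G \<Longrightarrow> p \<in> fst c \<Longrightarrow> p \<in> carrier G"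
  using atlas_openin openin_subset topspace_eq by blast

lemma atlas_cover: "\<Union> (fst ` gatlas G) = topspace (gtop G)"
  using lie by (simp add: lie_group_def manifold_def)

lemma smooth_mult:
  "smooth_map (prod_topology (gtop G) (gtop G)) (prod_atlas (gatlas G) (gatlas G))
    (gtop G) (gatlas G) (\<lambda>(x, y). x \<otimes> y)"
  using lie by (simp add: lie_group_def)

lemma smooth_inv: "smooth_map (gtop G) (gatlas G) (gtop G) (gatlas G) (\<lambda>x. inv x)"
  using lie by (simp add: lie_group_def)

lemma curve_carrier:
  "C1_curve (gtop G) (gatlas G) \<gamma> \<Longrightarrow> t \<in> {0..1} \<Longrightarrow> \<gamma> t \<in> carrier G"
  by (auto simp: C1_curve_def continuous_map_def topspace_eq Pi_iff)

lemma C1_curve_mult: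
  assumes "C1_curve (gtop G) (gatlas G) \<gamma>" "C1_curve (gtop G) (gatlas G) \<eta>"
  shows "C1_curve (gtop G) (gatlas G) (\<lambda>t. \<gamma> t \<otimes> \<eta> t)"
proof -
  have "C1_curve (gtop G) (gatlas G) (\<lambda>t. case (\<gamma> t, \<eta> t) of (x, y) \<Rightarrow> x \<otimes> y)"
  proof (rule C1_curve_smooth_map[OF smooth_mult _ _ _ C1_curve_pair[OF assms]])
    show "chart_on (prod_topology (gtop G) (gtop G)) c" if "c \<in> prod_atlas (gatlas G) (gatlas G)" for c
    proof -
      obtain a b where "a \<in> gatlas G" "b \<in> gatlas G" "c = (fst a \<times> fst b, map_prod (snd a) (snd b))"
        using \<open>c \<in> prod_atlas (gatlas G) (gatlas G)\<close> by (force simp: prod_atlas_def)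
      then show ?thesis using chart_on_prod atlas_chart_on by metis
    qed
    have "\<Union> (fst ` prod_atlas (gatlas G) (gatlas G)) = \<Union> (fst ` gatlas G) \<times> \<Union> (fst ` gatlas G)"
      by (force simp: prod_atlas_def)
    then show "\<Union> (fst ` prod_atlas (gatlas G) (gatlas G)) = topspace (prod_topology (gtop G) (gtop G))"
      by (simp add: atlas_cover)
  qed (rule atlas_openin)
  then show ?thesis by simp
qed

lemma C1_curve_inv:
  assumes "C1_curve (gtop G) (gatlas G) \<gamma>"
  shows "C1_curve (gtop G) (gatlas G) (\<lambda>t. inv (\<gamma> t))"
  by (rule C1_curve_smooth_map[OF smooth_inv atlas_chart_on atlas_cover atlas_openin assms])

lemma C1_curve_commutator:
  assumes "C1_curve (gtop G) (gatlas G) \<gamma>" "C1_curve (gtop G) (gatlas G) \<eta>"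
  shows "C1_curve (gtop G) (gatlas G) (\<lambda>t. commutator G (\<gamma> t) (\<eta> t))"
  unfolding commutator_def using assms by (intro C1_curve_mult C1_curve_inv)

section \<open>The group operations in a chart\<close>

lemma mult_C2_at:
  assumes "c \<in> gatlas G" "c' \<in> gatlas G" "d \<in> gatlas G" "p \<in> fst c" "q \<in> fst c'" "p \<otimes> q \<in> fst d"
  shows "C2_at (\<lambda>z. snd d (chart_inv c (fst z) \<otimes> chart_inv c' (snd z))) (snd c p, snd c' q)"
  using smooth_map_prod_C2_at[OF smooth_mult assms(1) atlas_chart_on assms(2) atlas_chart_on assms(3) atlas_openin] assms
  by simp

lemma C2_into_mult:
  assumes c: "c \<in> gatlas G" and k: "C2_into c k x" and l: "C2_into c l x" and kl: "k x \<otimes> l x \<in> fst c"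
  shows "C2_into c (\<lambda>z. k z \<otimes> l z) x"
  unfolding C2_into_def
proof
  have e: "\<forall>\<^sub>F z in nhds x. k z \<in> fst c" "\<forall>\<^sub>F z in nhds x. l z \<in> fst c"
    using k l by (auto simp: C2_into_def)
  have klx: "k x \<in> fst c" "l x \<in> fst c" using eventually_nhds_x_imp_x[OF e(1)] eventually_nhds_x_imp_x[OF e(2)] .
  note cc = atlas_chart_on[OF c]
  have p: "C2_at (\<lambda>z. (snd c (k z), snd c (l z))) x"
    using k l by (auto simp: C2_into_def intro: C2_at_Pair)
  have "openin (prod_topology (gtop G) (gtop G))
      {z \<in> topspace (prod_topology (gtop G) (gtop G)). (case z of (x, y) \<Rightarrow> x \<otimes> y) \<in> fst c}"
    using smooth_mult atlas_openin[OF c]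
    by (intro openin_continuous_map_preimage) (auto simp: smooth_map_def)
  from chart_on_eventually[OF chart_on_prod[OF cc cc] this, of "(k x, l x)"]
  have "\<forall>\<^sub>F z in nhds (snd c (k x), snd c (l x)).
      (case inv_into (fst c \<times> fst c) (map_prod (snd c) (snd c)) z of (x, y) \<Rightarrow> x \<otimes> y) \<in> fst c"
    using klx kl atlas_carrier[OF c] by (auto simp: topspace_eq elim: eventually_mono)
  then have "\<forall>\<^sub>F z in nhds x. (case inv_into (fst c \<times> fst c) (map_prod (snd c) (snd c))
      (snd c (k z), snd c (l z)) of (x, y) \<Rightarrow> x \<otimes> y) \<in> fst c"
    by (rule C2_at_eventually[OF p])
  with e show "\<forall>\<^sub>F z in nhds x. k z \<otimes> l z \<in> fst c"
    by eventually_elim (simp add: chart_inv_prod[OF cc cc] c)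
  have "C2_at (\<lambda>z. snd c (chart_inv c (fst (snd c (k z), snd c (l z))) \<otimes>
      chart_inv c (snd (snd c (k z), snd c (l z))))) x"
    by (rule C2_at_compose[OF p mult_C2_at[OF c c c klx kl]])
  then show "C2_at (\<lambda>z. snd c (k z \<otimes> l z)) x"
    by (rule C2_at_cong) (use e in eventually_elim, simp add: c)
qed

lemma C2_into_inv:
  assumes c: "c \<in> gatlas G" and k: "C2_into c k x" and kx: "inv (k x) \<in> fst c"
  shows "C2_into c (\<lambda>z. inv (k z)) x"
  unfolding C2_into_def
proof
  have e: "\<forall>\<^sub>F z in nhds x. k z \<in> fst c" and p: "C2_at (\<lambda>z. snd c (k z)) x"
    using k by (auto simp: C2_into_def)
  have k1: "k x \<in> fst c" using eventually_nhds_x_imp_x[OF e] .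
  note cc = atlas_chart_on[OF c]
  have "openin (gtop G) {z \<in> topspace (gtop G). inv z \<in> fst c}"
    using smooth_inv atlas_openin[OF c]
    by (intro openin_continuous_map_preimage) (auto simp: smooth_map_def)
  from chart_on_eventually[OF cc this, of "k x"]
  have "\<forall>\<^sub>F z in nhds (snd c (k x)). inv (chart_inv c z) \<in> fst c"
    using k1 kx atlas_carrier[OF c] by (auto simp: topspace_eq elim: eventually_mono)
  then have "\<forall>\<^sub>F z in nhds x. inv (chart_inv c (snd c (k z))) \<in> fst c"
    by (rule C2_at_eventually[OF p])
  with e show "\<forall>\<^sub>F z in nhds x. inv (k z) \<in> fst c"
    by eventually_elim (simp add: c)
  have "C2_at (\<lambda>z. snd c (inv (chart_inv c (snd c (k z))))) x"
    by (rule C2_at_compose[OF p smooth_map_C2_at[OF smooth_inv c cc c atlas_openin[OF c] k1 kx]])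
  then show "C2_at (\<lambda>z. snd c (inv (k z))) x"
    by (rule C2_at_cong) (use e in eventually_elim, simp add: c)
qed

lemma C2_into_chart_inv:
  assumes c: "c \<in> gatlas G" and f: "C2_at f x" "f x = snd c p" "p \<in> fst c"
  shows "C2_into c (\<lambda>z. chart_inv c (f z)) x"
  unfolding C2_into_def
proof
  have "\<forall>\<^sub>F z in nhds (f x). z \<in> snd c ` fst c"
    using atlas_chart_on[OF c] f(2,3) by (intro eventually_nhds_in_open) (auto simp: chart_on_def)
  then have e: "\<forall>\<^sub>F z in nhds x. f z \<in> snd c ` fst c"
    by (rule C2_at_eventually[OF f(1)])
  then show "\<forall>\<^sub>F z in nhds x. chart_inv c (f z) \<in> fst c"
    by eventually_elim (rule inv_into_into)
  show "C2_at (\<lambda>z. snd c (chart_inv c (f z))) x"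
    by (rule C2_at_cong[OF f(1)]) (use e in eventually_elim, simp add: f_inv_into_f)
qed

text \<open>At the base point every partial product of the commutator is \<one>, so the one chart c
  serves at each stage.\<close>

lemma commutator_C2_at:
  assumes c: "c \<in> gatlas G" "\<one> \<in> fst c"
  shows "C2_at (\<lambda>z. snd c (commutator G (chart_inv c (fst z)) (chart_inv c (snd z)))) (snd c \<one>, snd c \<one>)"
proof -
  let ?k = "\<lambda>z. chart_inv c (fst z)" and ?l = "\<lambda>z. chart_inv c (snd z)" and ?x = "(snd c \<one>, snd c \<one>)"
  have k: "C2_into c ?k ?x" by (rule C2_into_chart_inv[OF c(1) C2_at_fst _ c(2)]) simp
  have l: "C2_into c ?l ?x" by (rule C2_into_chart_inv[OF c(1) C2_at_snd _ c(2)]) simp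
  have i: "C2_into c (\<lambda>z. inv (?k z)) ?x"
    by (rule C2_into_inv[OF c(1) k]) (simp add: c)
  have j: "C2_into c (\<lambda>z. inv (?l z)) ?x"
    by (rule C2_into_inv[OF c(1) l]) (simp add: c)
  have "C2_into c (\<lambda>z. ?k z \<otimes> ?l z) ?x"
    by (rule C2_into_mult[OF c(1) k l]) (simp add: c)
  from C2_into_mult[OF c(1) this i] have "C2_into c (\<lambda>z. ?k z \<otimes> ?l z \<otimes> inv (?k z)) ?x"
    by (simp add: c)
  from C2_into_mult[OF c(1) this j] have "C2_into c (\<lambda>z. commutator G (?k z) (?l z)) ?x"
    by (simp add: c commutator_def)
  then show ?thesis by (simp add: C2_into_def)
qed

section \<open>Second order behaviour of the commutator curve\<close>

lemma curve_velocity_apply: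
  assumes \<gamma>: "C1_curve (gtop G) (gatlas G) \<gamma>" "\<gamma> 0 = \<one>" and c: "c \<in> gatlas G" "\<one> \<in> fst c"
  shows "((\<lambda>s. (1 / s) *\<^sub>R (snd c (\<gamma> s) - snd c \<one>)) \<longlongrightarrow> curve_velocity (gatlas G) {0..1} \<gamma> 0 c)
    (at 0 within {0..1})"
proof -
  obtain \<alpha> where "curve_deriv c \<gamma> \<alpha>" using \<gamma>(1) c(1) by (auto simp: C1_curve_iff)
  from curve_derivD(1)[OF this, of 0] \<gamma>(2) c(2)
  have *: "((\<lambda>s. (1 / s) *\<^sub>R (snd c (\<gamma> s) - snd c \<one>)) \<longlongrightarrow> \<alpha> 0) (at 0 within {0..1})"
    by simp
  then have "Lim (at 0 within {0..1}) (\<lambda>s. (1 / s) *\<^sub>R (snd c (\<gamma> s) - snd c \<one>)) = \<alpha> 0"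
    by (intro tendsto_Lim) auto
  with * show ?thesis using c \<gamma>(2) by (simp add: curve_velocity_def charts_at_def)
qed

lemma curve_in_chart:
  assumes \<gamma>: "C1_curve (gtop G) (gatlas G) \<gamma>" and t: "t \<in> {0..1}" and c: "c \<in> gatlas G" "\<gamma> t \<in> fst c"
  shows "\<forall>\<^sub>F s in at t within {0..1}. s \<in> {0..1} \<and> \<gamma> s \<in> fst c"
    "((\<lambda>s. snd c (\<gamma> s)) \<longlongrightarrow> snd c (\<gamma> t)) (at t within {0..1})"
proof -
  have \<gamma>': "continuous_map (top_of_set {0..1}) (gtop G) \<gamma>" using \<gamma> by (simp add: C1_curve_def)
  have "\<forall>\<^sub>F s in at t within {0..1}. s \<in> {0..1}" by (simp add: eventually_at_filter)
  with curve_eventually[OF \<gamma>' atlas_openin[OF c(1)] t c(2)]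
  show "\<forall>\<^sub>F s in at t within {0..1}. s \<in> {0..1} \<and> \<gamma> s \<in> fst c"
    by eventually_elim simp
  show "((\<lambda>s. snd c (\<gamma> s)) \<longlongrightarrow> snd c (\<gamma> t)) (at t within {0..1})"
    by (rule curve_chart_tendsto[OF \<gamma>' atlas_chart_on[OF c(1)] t c(2)])
qed

text \<open>By linearity, \<delta> s is dF in the direction (\<alpha> s, 0) plus dF in the direction
  (0, \<beta> s). Each summand vanishes when the other variable is put back to x0, so after division
  by s it becomes a difference quotient of dF and tends to a mixed second derivative. Both limits
  are L, which accounts for the 2 in \<open>1 / (2 * s)\<close>; the same factor appears when
  \<kappa>(\<surd>t) is differentiated.\<close>

lemma commutator_curve_limits:
  assumes \<gamma>: "C1_curve (gtop G) (gatlas G) \<gamma>" "\<gamma> 0 = \<one>"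
    and \<eta>: "C1_curve (gtop G) (gatlas G) \<eta>" "\<eta> 0 = \<one>"
    and c: "c \<in> gatlas G" "\<one> \<in> fst c"
    and \<delta>: "curve_deriv c (\<lambda>t. commutator G (\<gamma> t) (\<eta> t)) \<delta>"
  obtains L where
    "((\<lambda>s. (1 / s\<^sup>2) *\<^sub>R (snd c (commutator G (\<gamma> s) (\<eta> s)) - snd c \<one>)) \<longlongrightarrow> L) (at 0 within {0..1})"
    "((\<lambda>s. (1 / (2 * s)) *\<^sub>R \<delta> s) \<longlongrightarrow> L) (at 0 within {0..1})"
proof -
  let ?F = "at 0 within {0..1::real}"
  let ?I = "{0..1::real}"
  define F where "F z = snd c (commutator G (chart_inv c (fst z)) (chart_inv c (snd z)))" for z
  define x where "x s = snd c (\<gamma> s)" for s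
  define y where "y s = snd c (\<eta> s)" for s
  define x0 where "x0 = snd c \<one>"
  obtain \<alpha> where \<alpha>: "curve_deriv c \<gamma> \<alpha>" using \<gamma>(1) c(1) by (auto simp: C1_curve_iff)
  obtain \<beta> where \<beta>: "curve_deriv c \<eta> \<beta>" using \<eta>(1) c(1) by (auto simp: C1_curve_iff)
  have "C2_at F (x0, x0)"
    unfolding F_def x0_def by (rule commutator_C2_at[OF c])
  then obtain U dF ddF where U: "(x0, x0) \<in> U" and F: "C2_with U F dF ddF"
    by (auto simp: C2_at_def)
  then have F1: "C1_with U F dF" and F2: "C1_with (U \<times> UNIV) dF ddF" by (auto simp: C2_with_def)
  have I0: "0 \<in> ?I" by simp
  have c\<gamma>: "\<gamma> 0 \<in> fst c" and c\<eta>: "\<eta> 0 \<in> fst c" using \<gamma> \<eta> c by auto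
  have ev: "\<forall>\<^sub>F s in ?F. s \<in> ?I \<and> \<gamma> s \<in> fst c" "\<forall>\<^sub>F s in ?F. s \<in> ?I \<and> \<eta> s \<in> fst c"
    using curve_in_chart(1)[OF \<gamma>(1) I0 c(1) c\<gamma>] curve_in_chart(1)[OF \<eta>(1) I0 c(1) c\<eta>] .
  have ne: "\<forall>\<^sub>F s in ?F. s \<noteq> 0" by (rule eventually_neq_at_within)
  have x: "(x \<longlongrightarrow> x0) ?F" and y: "(y \<longlongrightarrow> x0) ?F"
    using curve_in_chart(2)[OF \<gamma>(1) I0 c(1) c\<gamma>] curve_in_chart(2)[OF \<eta>(1) I0 c(1) c\<eta>]
    by (simp_all add: x_def[abs_def] y_def[abs_def] x0_def \<gamma>(2) \<eta>(2))
  have dx: "((\<lambda>s. (1 / s) *\<^sub>R (x s - x0)) \<longlongrightarrow> \<alpha> 0) ?F" and dy: "((\<lambda>s. (1 / s) *\<^sub>R (y s - x0)) \<longlongrightarrow> \<beta> 0) ?F"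
    using curve_derivD(1)[OF \<alpha> I0 c\<gamma>] curve_derivD(1)[OF \<beta> I0 c\<eta>]
    by (simp_all add: x_def[abs_def] y_def[abs_def] x0_def \<gamma>(2) \<eta>(2))
  have \<gamma>': "continuous_map (top_of_set ?I) (gtop G) \<gamma>" and \<eta>': "continuous_map (top_of_set ?I) (gtop G) \<eta>"
    using \<gamma> \<eta> by (auto simp: C1_curve_def)
  have \<alpha>t: "(\<alpha> \<longlongrightarrow> \<alpha> 0) ?F" and \<beta>t: "(\<beta> \<longlongrightarrow> \<beta> 0) ?F"
    using curve_deriv_tendsto[OF \<gamma>' atlas_chart_on[OF c(1)] \<alpha> I0 c\<gamma>]
      curve_deriv_tendsto[OF \<eta>' atlas_chart_on[OF c(1)] \<beta> I0 c\<eta>] .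
  have Fxy: "F (snd c p, snd c q) = snd c (commutator G p q)" if "p \<in> fst c" "q \<in> fst c" for p q
    using that c by (simp add: F_def)
  have Fx0: "F (z, x0) = x0" "F (x0, z) = x0" if "z \<in> snd c ` fst c" for z
    using that c atlas_carrier[OF c(1)] by (auto simp: F_def x0_def)
  define L where "L = ddF (((x0, x0), (\<alpha> 0, 0)), ((0, \<beta> 0), 0))"
  \<comment> \<open>Three of the four corners lie on the axes, where F has the value x0, so the
    second difference is F (x s, y s) - x0.\<close>
  have "((\<lambda>s. (1 / s\<^sup>2) *\<^sub>R (F ((x0, x0) + (x s - x0, 0) + (0, y s - x0)) - F ((x0, x0) + (x s - x0, 0))
      - F ((x0, x0) + (0, y s - x0)) + F (x0, x0))) \<longlongrightarrow> L) ?F"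
    unfolding L_def
  proof (rule second_difference_tendsto[OF F U])
    show "((\<lambda>s. (1 / s) *\<^sub>R (x s - x0, 0::'e)) \<longlongrightarrow> (\<alpha> 0, 0)) ?F"
      using tendsto_Pair[OF dx tendsto_const[of "0::'e"]] by simp
    show "((\<lambda>s. (1 / s) *\<^sub>R (0::'e, y s - x0)) \<longlongrightarrow> (0, \<beta> 0)) ?F"
      using tendsto_Pair[OF tendsto_const[of "0::'e"] dy] by simp
  qed (use ne in auto)
  then have L1: "((\<lambda>s. (1 / s\<^sup>2) *\<^sub>R (snd c (commutator G (\<gamma> s) (\<eta> s)) - snd c \<one>)) \<longlongrightarrow> L) ?F"
  proof (rule Lim_transform_eventually)
    show "\<forall>\<^sub>F s in ?F. (1 / s\<^sup>2) *\<^sub>R (F ((x0, x0) + (x s - x0, 0) + (0, y s - x0)) - F ((x0, x0) + (x s - x0, 0))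
      - F ((x0, x0) + (0, y s - x0)) + F (x0, x0)) = (1 / s\<^sup>2) *\<^sub>R (snd c (commutator G (\<gamma> s) (\<eta> s)) - snd c \<one>)"
      using ev
    proof eventually_elim
      case (elim s)
      have "F (x s, y s) = snd c (commutator G (\<gamma> s) (\<eta> s))" "F (x s, x0) = x0" "F (x0, y s) = x0" "F (x0, x0) = x0"
        using elim c(2) by (auto simp: x_def y_def Fxy intro!: Fx0) (auto simp: x0_def)
      then show ?case by (simp add: x0_def)
    qed
  qed
  \<comment> \<open>F is known to be constant on an axis only inside the image of the chart; that
    image is open, so z + t w stays in it for small t.\<close>
  have dF0: "dF ((z, x0), (w, 0)) = 0" "dF ((x0, z), (0, w)) = 0"
    if z: "z \<in> snd c ` fst c" and zU: "(z, x0) \<in> U" "(x0, z) \<in> U" for z w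
  proof -
    have "((\<lambda>t. z + t *\<^sub>R w) \<longlongrightarrow> z) (at (0::real))"
      by (rule tendsto_line)
    from topological_tendstoD[OF this _ z]
    have e: "\<forall>\<^sub>F t in at (0::real). z + t *\<^sub>R w \<in> snd c ` fst c"
      using atlas_chart_on[OF c(1)] by (simp add: chart_on_def)
    have "((\<lambda>t. (1 / t) *\<^sub>R (F ((z, x0) + t *\<^sub>R (w, 0)) - F (z, x0))) \<longlongrightarrow> 0) (at 0)"
      by (rule tendsto_eventually) (use e in eventually_elim, simp add: Fx0 z)
    from tendsto_unique[OF _ C1_withD(4)[OF F1 zU(1)] this] show "dF ((z, x0), (w, 0)) = 0" by simp
    have "((\<lambda>t. (1 / t) *\<^sub>R (F ((x0, z) + t *\<^sub>R (0, w)) - F (x0, z))) \<longlongrightarrow> 0) (at 0)"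
      by (rule tendsto_eventually) (use e in eventually_elim, simp add: Fx0 z)
    from tendsto_unique[OF _ C1_withD(4)[OF F1 zU(2)] this] show "dF ((x0, z), (0, w)) = 0" by simp
  qed
  have a: "((\<lambda>s. (1 / s) *\<^sub>R (dF ((x s, y s), (\<alpha> s, 0)) - dF ((x s, x0), (\<alpha> s, 0)))) \<longlongrightarrow> L) ?F"
    unfolding L_def
  proof (rule C1_with_strict[OF F2])
    show "((\<lambda>s. (1 / s) *\<^sub>R (((x s, y s), (\<alpha> s, 0::'e)) - ((x s, x0), (\<alpha> s, 0)))) \<longlongrightarrow> ((0, \<beta> 0), 0)) ?F"
      using tendsto_Pair[OF tendsto_Pair[OF tendsto_const[of "0::'e"] dy] tendsto_const[of "0::'e \<times> 'e"]]
      by (simp add: zero_prod_def)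
  qed (use U ne in \<open>auto intro!: tendsto_Pair x y \<alpha>t\<close>)
  \<comment> \<open>Now the first variable moves, and the mixed derivative appears in the opposite
    order.\<close>
  have "((\<lambda>s. (1 / s) *\<^sub>R (dF ((x s, y s), (0, \<beta> s)) - dF ((x0, y s), (0, \<beta> s)))) \<longlongrightarrow>
      ddF (((x0, x0), (0, \<beta> 0)), ((\<alpha> 0, 0), 0))) ?F"
  proof (rule C1_with_strict[OF F2])
    show "((\<lambda>s. (1 / s) *\<^sub>R (((x s, y s), (0::'e, \<beta> s)) - ((x0, y s), (0, \<beta> s)))) \<longlongrightarrow> ((\<alpha> 0, 0), 0)) ?F"
      using tendsto_Pair[OF tendsto_Pair[OF dx tendsto_const[of "0::'e"]] tendsto_const[of "0::'e \<times> 'e"]]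
      by (simp add: zero_prod_def)
  qed (use U ne in \<open>auto intro!: tendsto_Pair x y \<beta>t\<close>)
  then have b: "((\<lambda>s. (1 / s) *\<^sub>R (dF ((x s, y s), (0, \<beta> s)) - dF ((x0, y s), (0, \<beta> s)))) \<longlongrightarrow> L) ?F"
    unfolding L_def C2_with_symmetric[OF F U, of "(\<alpha> 0, 0)"] .
  \<comment> \<open>\<open>dF0\<close> asks for (z, x0) and (x0, z) at once; the last two
    memberships complete the pairs for z = x s and z = y s.\<close>
  have evU: "\<forall>\<^sub>F s in ?F. (x s, y s) \<in> U" "\<forall>\<^sub>F s in ?F. (x s, x0) \<in> U" "\<forall>\<^sub>F s in ?F. (x0, y s) \<in> U"
    "\<forall>\<^sub>F s in ?F. (x0, x s) \<in> U" "\<forall>\<^sub>F s in ?F. (y s, x0) \<in> U"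
    using U C1_withD(1)[OF F1] x y by (auto intro!: topological_tendstoD tendsto_Pair)
  have "commutator G (\<gamma> 0) (\<eta> 0) \<in> fst c" using \<gamma> \<eta> c by simp
  from curve_in_chart(1)[OF C1_curve_commutator[OF \<gamma>(1) \<eta>(1)] I0 c(1) this]
  have evc: "\<forall>\<^sub>F s in ?F. commutator G (\<gamma> s) (\<eta> s) \<in> fst c" by eventually_elim simp
  have "\<forall>\<^sub>F s in ?F. (1 / s) *\<^sub>R (dF ((x s, y s), (\<alpha> s, 0)) - dF ((x s, x0), (\<alpha> s, 0))) +
      (1 / s) *\<^sub>R (dF ((x s, y s), (0, \<beta> s)) - dF ((x0, y s), (0, \<beta> s))) = (1 / s) *\<^sub>R \<delta> s"
    using ev evU evc
  proof eventually_elim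
    case (elim s)
    have sI: "s \<in> ?I" and g: "\<gamma> s \<in> fst c" and h: "\<eta> s \<in> fst c" using elim by auto
    have "((\<lambda>r. (1 / (r - s)) *\<^sub>R (F (x r, y r) - F (x s, y s))) \<longlongrightarrow> dF ((x s, y s), (\<alpha> s, \<beta> s))) (at s within ?I)"
    proof (rule C1_with_curve[OF F1, where x = "\<lambda>r. (x r, y r)"])
      show "((\<lambda>r. (x r, y r)) \<longlongrightarrow> (x s, y s)) (at s within ?I)"
        unfolding x_def y_def
        by (intro tendsto_Pair curve_in_chart(2)[OF \<gamma>(1) sI c(1) g] curve_in_chart(2)[OF \<eta>(1) sI c(1) h])
      show "((\<lambda>r. (1 / (r - s)) *\<^sub>R ((x r, y r) - (x s, y s))) \<longlongrightarrow> (\<alpha> s, \<beta> s)) (at s within ?I)"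
        using tendsto_Pair[OF curve_derivD(1)[OF \<alpha> sI g] curve_derivD(1)[OF \<beta> sI h]]
        by (simp add: x_def y_def)
    qed (use elim in auto)
    moreover have "\<forall>\<^sub>F r in at s within ?I. (1 / (r - s)) *\<^sub>R (F (x r, y r) - F (x s, y s)) =
       (1 / (r - s)) *\<^sub>R (snd c (commutator G (\<gamma> r) (\<eta> r)) - snd c (commutator G (\<gamma> s) (\<eta> s)))"
      using curve_in_chart(1)[OF \<gamma>(1) sI c(1) g] curve_in_chart(1)[OF \<eta>(1) sI c(1) h]
      by eventually_elim (simp add: x_def y_def Fxy g h)
    ultimately have "((\<lambda>r. (1 / (r - s)) *\<^sub>R (snd c (commutator G (\<gamma> r) (\<eta> r)) - snd c (commutator G (\<gamma> s) (\<eta> s))))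
        \<longlongrightarrow> dF ((x s, y s), (\<alpha> s, \<beta> s))) (at s within ?I)"
      by (rule Lim_transform_eventually)
    moreover have "((\<lambda>r. (1 / (r - s)) *\<^sub>R (snd c (commutator G (\<gamma> r) (\<eta> r)) - snd c (commutator G (\<gamma> s) (\<eta> s))))
        \<longlongrightarrow> \<delta> s) (at s within ?I)"
      using elim by (intro curve_derivD(1)[OF \<delta> sI]) auto
    ultimately have "\<delta> s = dF ((x s, y s), (\<alpha> s, \<beta> s))"
      using sI by (intro tendsto_unique[of "at s within ?I"]) auto
    also have "\<dots> = dF ((x s, y s), (\<alpha> s, 0)) + dF ((x s, y s), (0, \<beta> s))"
      using C1_with_add[OF F1, of "(x s, y s)" "(\<alpha> s, 0)" "(0, \<beta> s)"] elim by simp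
    finally have "\<delta> s = dF ((x s, y s), (\<alpha> s, 0)) + dF ((x s, y s), (0, \<beta> s))" .
    moreover have "dF ((x s, x0), (\<alpha> s, 0)) = 0" "dF ((x0, y s), (0, \<beta> s)) = 0"
      using elim by (auto intro!: dF0 simp: x_def y_def)
    ultimately show ?case by (simp add: scaleR_add_right)
  qed
  from Lim_transform_eventually[OF tendsto_add[OF a b] this]
  have "((\<lambda>s. (1 / 2) *\<^sub>R ((1 / s) *\<^sub>R \<delta> s)) \<longlongrightarrow> (1 / 2) *\<^sub>R (L + L)) ?F"
    by (rule tendsto_scaleR_lcs[OF tendsto_const])
  moreover have "(1 / 2) *\<^sub>R (L + L) = L" by (simp add: scaleR_half_double)
  ultimately have "((\<lambda>s. (1 / (2 * s)) *\<^sub>R \<delta> s) \<longlongrightarrow> L) ?F" by simp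
  with L1 show thesis by (rule that)
qed

section \<open>Identification of the limit with the Lie bracket\<close>

text \<open>This repeats literally the choice made by \<open>tangent_map\<close> at \<one>, so that
  it matches after unfolding.\<close>

definition base_chart :: "('g, 'e) chart" where
  "base_chart = (SOME c. c \<in> charts_at (gatlas G) \<one>)"

lemma base_chart: "base_chart \<in> gatlas G" "\<one> \<in> fst base_chart"
proof -
  have "\<one> \<in> \<Union> (fst ` gatlas G)" unfolding atlas_cover topspace_eq by simp
  then have "\<exists>c. c \<in> charts_at (gatlas G) \<one>" by (auto simp: charts_at_def)
  then have "base_chart \<in> charts_at (gatlas G) \<one>" unfolding base_chart_def by (rule someI_ex)
  then show "base_chart \<in> gatlas G" "\<one> \<in> fst base_chart" by (auto simp: charts_at_def)
qed

text \<open>The left invariant fields are given by derivatives in the arbitrarily chosen \<open>base_chart\<close>, while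
  their components are taken in \<open>c\<close>. Expressing the second factor of the product in \<open>base_chart\<close> makes
  a comparison of the two charts unnecessary.\<close>

lemma mult_second_difference:
  assumes \<gamma>: "C1_curve (gtop G) (gatlas G) \<gamma>" "\<gamma> 0 = \<one>"
    and \<eta>: "C1_curve (gtop G) (gatlas G) \<eta>" "\<eta> 0 = \<one>"
    and c: "c \<in> gatlas G" "\<one> \<in> fst c"
  defines "X \<equiv> \<lambda>z. left_invariant_field G (curve_velocity (gatlas G) {0..1} \<gamma> 0) (chart_inv c z) c"
    and "Y \<equiv> \<lambda>z. left_invariant_field G (curve_velocity (gatlas G) {0..1} \<eta> 0) (chart_inv c z) c"
  shows "((\<lambda>s. (1 / s\<^sup>2) *\<^sub>R (snd c (\<gamma> s \<otimes> \<eta> s) - snd c (\<gamma> s) - snd c (\<eta> s) + snd c \<one>))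
    \<longlongrightarrow> dir_deriv Y (snd c \<one>) (X (snd c \<one>))) (at 0 within {0..1})"
proof -
  let ?F = "at 0 within {0..1::real}"
  let ?I = "{0..1::real}"
  define b where "b = base_chart"
  have b: "b \<in> gatlas G" "\<one> \<in> fst b" using base_chart by (simp_all add: b_def)
  define v where "v = curve_velocity (gatlas G) {0..1} \<gamma> 0"
  define w where "w = curve_velocity (gatlas G) {0..1} \<eta> 0"
  define M where "M z = snd c (chart_inv c (fst z) \<otimes> chart_inv b (snd z))" for z
  define x0 where "x0 = snd c \<one>"
  define y0 where "y0 = snd b \<one>"
  have "C2_at M (x0, y0)"
    unfolding M_def x0_def y0_def using b c by (intro mult_C2_at) auto
  then obtain U dM ddM where U: "(x0, y0) \<in> U" and M: "C2_with U M dM ddM"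
    by (auto simp: C2_at_def)
  then have M1: "C1_with U M dM" and M2: "C1_with (U \<times> UNIV) dM ddM" by (auto simp: C2_with_def)
  have I0: "0 \<in> ?I" by simp
  have ne: "\<forall>\<^sub>F s in ?F. s \<noteq> 0" by (rule eventually_neq_at_within)
  have Mpq: "M (snd c p, snd b q) = snd c (p \<otimes> q)" if "p \<in> fst c" "q \<in> fst b" for p q
    using that b c by (simp add: M_def)
  have M0: "M (z, y0) = z" if "z \<in> snd c ` fst c" for z
    using that b c atlas_carrier[OF c(1)] by (auto simp: M_def y0_def)
  have openc: "open (snd c ` fst c)" using atlas_chart_on[OF c(1)] by (simp add: chart_on_def)
  \<comment> \<open>The tangent map of left translation is the partial derivative of M in the second
    argument; the variation of the field with z is then contained in ddM.\<close>
  have field: "left_invariant_field G u (chart_inv c z) c = dM ((z, y0), (0, u b))"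
    if z: "z \<in> snd c ` fst c" "(z, y0) \<in> U" for u z
  proof -
    let ?g = "chart_inv c z"
    have g: "?g \<in> fst c" using z(1) by (rule inv_into_into)
    then have "c \<in> charts_at (gatlas G) (?g \<otimes> \<one>)"
      using c atlas_carrier[OF c(1)] by (simp add: charts_at_def)
    then have "left_invariant_field G u ?g c = dir_deriv (snd c \<circ> (\<lambda>h. ?g \<otimes> h) \<circ> chart_inv b) y0 (u b)"
      by (simp add: left_invariant_field_def tangent_map_def b_def base_chart_def y0_def Let_def)
    also have "\<dots> = Lim (at 0) (\<lambda>t. (1 / t) *\<^sub>R (M ((z, y0) + t *\<^sub>R (0, u b)) - M (z, y0)))"
      by (simp add: dir_deriv_def M_def comp_def)
    also have "\<dots> = dM ((z, y0), (0, u b))"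
      by (intro tendsto_Lim C1_withD(4)[OF M1 z(2)]) simp
    finally show ?thesis .
  qed
  have x0: "x0 \<in> snd c ` fst c" using c by (simp add: x0_def)
  have c\<gamma>: "\<gamma> 0 \<in> fst c" "\<gamma> 0 \<in> fst b" and c\<eta>: "\<eta> 0 \<in> fst c" "\<eta> 0 \<in> fst b" using \<gamma> \<eta> b c by auto
  note ev = curve_in_chart(1)[OF \<gamma>(1) I0 c(1) c\<gamma>(1)] curve_in_chart(1)[OF \<gamma>(1) I0 b(1) c\<gamma>(2)]
    curve_in_chart(1)[OF \<eta>(1) I0 c(1) c\<eta>(1)] curve_in_chart(1)[OF \<eta>(1) I0 b(1) c\<eta>(2)]
  have d\<gamma>: "((\<lambda>s. (1 / s) *\<^sub>R (snd c (\<gamma> s) - x0)) \<longlongrightarrow> v c) ?F"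
      "((\<lambda>s. (1 / s) *\<^sub>R (snd b (\<gamma> s) - y0)) \<longlongrightarrow> v b) ?F"
    and d\<eta>: "((\<lambda>s. (1 / s) *\<^sub>R (snd b (\<eta> s) - y0)) \<longlongrightarrow> w b) ?F"
    unfolding v_def w_def x0_def y0_def
    by (intro curve_velocity_apply \<gamma> \<eta> b c)+
  \<comment> \<open>Since x0 represents \<one>, M (x0, _) is the change from chart b to chart c.
    Sending \<gamma> through it relates v b to v c.\<close>
  have "((\<lambda>s. (1 / s) *\<^sub>R (M (x0, snd b (\<gamma> s)) - M (x0, y0))) \<longlongrightarrow> dM ((x0, y0), (0, v b))) ?F"
  proof (rule C1_with_strict[OF M1 U tendsto_const _ ne])
    show "((\<lambda>s. (x0, snd b (\<gamma> s))) \<longlongrightarrow> (x0, y0)) ?F"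
      using curve_in_chart(2)[OF \<gamma>(1) I0 b(1) c\<gamma>(2)] \<gamma>(2)
      by (intro tendsto_Pair tendsto_const) (simp add: y0_def)
    show "((\<lambda>s. (1 / s) *\<^sub>R ((x0, snd b (\<gamma> s)) - (x0, y0))) \<longlongrightarrow> (0, v b)) ?F"
      using tendsto_Pair[OF tendsto_const[of "0::'e"] d\<gamma>(2)] by simp
  qed
  moreover have "((\<lambda>s. (1 / s) *\<^sub>R (M (x0, snd b (\<gamma> s)) - M (x0, y0))) \<longlongrightarrow> v c) ?F"
  proof (rule Lim_transform_eventually[OF d\<gamma>(1)])
    show "\<forall>\<^sub>F s in ?F. (1 / s) *\<^sub>R (snd c (\<gamma> s) - x0) = (1 / s) *\<^sub>R (M (x0, snd b (\<gamma> s)) - M (x0, y0))"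
      using ev(1,2)
      by eventually_elim (use c b atlas_carrier[OF c(1)] M0[OF x0] in \<open>simp add: Mpq x0_def\<close>)
  qed
  ultimately have "dM ((x0, y0), (0, v b)) = v c"
    by (intro tendsto_unique[of ?F]) auto
  then have Xv: "X x0 = v c" using field[OF x0 U] by (simp add: X_def v_def)
  have Y: "Y z = dM ((z, y0), (0, w b))" if "z \<in> snd c ` fst c" "(z, y0) \<in> U" for z
    using field[OF that] by (simp add: Y_def w_def)
  have "dir_deriv Y x0 (v c) = ddM (((x0, y0), (0, w b)), ((v c, 0), 0))"
    unfolding dir_deriv_def
  proof (rule tendsto_Lim)
    have z: "((\<lambda>t. x0 + t *\<^sub>R v c) \<longlongrightarrow> x0) (at (0::real))"
      by (rule tendsto_line)
    have "((x0, y0), (0, w b)) \<in> U \<times> UNIV" using U by simp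
    from C1_withD(4)[OF M2 this, of "((v c, 0), 0)"]
    show "((\<lambda>t. (1 / t) *\<^sub>R (Y (x0 + t *\<^sub>R v c) - Y x0)) \<longlongrightarrow> ddM (((x0, y0), (0, w b)), ((v c, 0), 0))) (at 0)"
    proof (rule Lim_transform_eventually)
      have "((\<lambda>t. (x0 + t *\<^sub>R v c, y0)) \<longlongrightarrow> (x0, y0)) (at (0::real))" by (intro tendsto_Pair z tendsto_const)
      from topological_tendstoD[OF this C1_withD(1)[OF M1] U] topological_tendstoD[OF z openc x0]
      show "\<forall>\<^sub>F t in at 0. (1 / t) *\<^sub>R (dM (((x0, y0), (0, w b)) + t *\<^sub>R ((v c, 0), 0)) - dM ((x0, y0), (0, w b))) =
          (1 / t) *\<^sub>R (Y (x0 + t *\<^sub>R v c) - Y x0)"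
        by eventually_elim (simp add: Y x0 U)
    qed
  qed simp
  \<comment> \<open>The increment of \<eta> comes first and that of \<gamma> second, so the limit
    has the order of differentiation found for \<open>dir_deriv Y\<close>.\<close>
  moreover have "((\<lambda>s. (1 / s\<^sup>2) *\<^sub>R (M ((x0, y0) + (0, snd b (\<eta> s) - y0) + (snd c (\<gamma> s) - x0, 0))
      - M ((x0, y0) + (0, snd b (\<eta> s) - y0)) - M ((x0, y0) + (snd c (\<gamma> s) - x0, 0)) + M (x0, y0)))
      \<longlongrightarrow> ddM (((x0, y0), (0, w b)), ((v c, 0), 0))) ?F"
  proof (rule second_difference_tendsto[OF M U])
    show "((\<lambda>s. (1 / s) *\<^sub>R (snd c (\<gamma> s) - x0, 0::'e)) \<longlongrightarrow> (v c, 0)) ?F"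
      using tendsto_Pair[OF d\<gamma>(1) tendsto_const[of "0::'e"]] by simp
    show "((\<lambda>s. (1 / s) *\<^sub>R (0::'e, snd b (\<eta> s) - y0)) \<longlongrightarrow> (0, w b)) ?F"
      using tendsto_Pair[OF tendsto_const[of "0::'e"] d\<eta>] by simp
  qed (use ne in auto)
  moreover have "\<forall>\<^sub>F s in ?F. (1 / s\<^sup>2) *\<^sub>R (M ((x0, y0) + (0, snd b (\<eta> s) - y0) + (snd c (\<gamma> s) - x0, 0))
      - M ((x0, y0) + (0, snd b (\<eta> s) - y0)) - M ((x0, y0) + (snd c (\<gamma> s) - x0, 0)) + M (x0, y0)) =
      (1 / s\<^sup>2) *\<^sub>R (snd c (\<gamma> s \<otimes> \<eta> s) - snd c (\<gamma> s) - snd c (\<eta> s) + snd c \<one>)"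
    using ev
  proof eventually_elim
    case (elim s)
    \<comment> \<open>Multiplication by \<one> turns the coordinates of \<eta> in b into those in
      c.\<close>
    have "M (x0, snd b (\<eta> s)) = snd c (\<eta> s)"
      using elim c atlas_carrier[OF c(1)] by (simp add: x0_def Mpq)
    moreover have "M (snd c (\<gamma> s), snd b (\<eta> s)) = snd c (\<gamma> s \<otimes> \<eta> s)"
      "M (snd c (\<gamma> s), y0) = snd c (\<gamma> s)" "M (x0, y0) = x0"
      using elim x0 by (simp_all add: Mpq M0)
    ultimately show ?case by (simp add: x0_def)
  qed
  ultimately show ?thesis
    using Xv by (auto simp: x0_def elim: Lim_transform_eventually)
qed

text \<open>The quotient of \<gamma>\<eta> - \<eta>\<gamma> by s^2 is computed twice: from the
  second differences of the two products it tends to the bracket, and from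
  \<open>commutator_mult\<close> it tends to the derivative of the multiplication in the direction
  (L, 0), which is L.\<close>

lemma commutator_curve_limit_eq:
  assumes \<gamma>: "C1_curve (gtop G) (gatlas G) \<gamma>" "\<gamma> 0 = \<one>"
    and \<eta>: "C1_curve (gtop G) (gatlas G) \<eta>" "\<eta> 0 = \<one>"
    and c: "c \<in> gatlas G" "\<one> \<in> fst c"
    and L: "((\<lambda>s. (1 / s\<^sup>2) *\<^sub>R (snd c (commutator G (\<gamma> s) (\<eta> s)) - snd c \<one>)) \<longlongrightarrow> L) (at 0 within {0..1})"
  shows "L = lie_bracket G (curve_velocity (gatlas G) {0..1} \<gamma> 0) (curve_velocity (gatlas G) {0..1} \<eta> 0) c"
    (is "L = ?B")
proof -
  let ?F = "at 0 within {0..1::real}"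
  let ?I = "{0..1::real}"
  define k where "k s = snd c (commutator G (\<gamma> s) (\<eta> s))" for s
  define p where "p s = snd c (\<eta> s \<otimes> \<gamma> s)" for s
  define x0 where "x0 = snd c \<one>"
  have I0: "0 \<in> ?I" by simp
  have ne: "\<forall>\<^sub>F s in ?F. s\<^sup>2 \<noteq> 0"
    using eventually_neq_at_within[of 0 0 ?I] by (rule eventually_mono) simp
  \<comment> \<open>This removes the coordinates of \<gamma> s, \<eta> s and \<one>, which both
    second differences share.\<close>
  have "\<And>a b d e::'e. (a - b - d + e) - (f - d - b + e) = a - f" for f by simp
  with tendsto_diff[OF mult_second_difference[OF \<gamma> \<eta> c] mult_second_difference[OF \<eta> \<gamma> c]]
  have B: "((\<lambda>s. (1 / s\<^sup>2) *\<^sub>R (snd c (\<gamma> s \<otimes> \<eta> s) - p s)) \<longlongrightarrow> ?B) ?F"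
    using c by (simp add: lie_bracket_def vector_field_bracket_def charts_at_def Let_def p_def
        scaleR_diff_right[symmetric])
  define \<mu> where "\<mu> z = snd c (chart_inv c (fst z) \<otimes> chart_inv c (snd z))" for z
  have "C2_at \<mu> (x0, x0)"
    unfolding \<mu>_def x0_def using c by (intro mult_C2_at) auto
  then obtain U d\<mu> where U: "(x0, x0) \<in> U" and \<mu>1: "C1_with U \<mu> d\<mu>"
    by (auto simp: C2_at_def C2_with_def)
  have one: "commutator G (\<gamma> 0) (\<eta> 0) = \<one>" "\<eta> 0 \<otimes> \<gamma> 0 = \<one>" using \<gamma> \<eta> by simp_all
  note Ck = C1_curve_commutator[OF \<gamma>(1) \<eta>(1)] and Cp = C1_curve_mult[OF \<eta>(1) \<gamma>(1)]
  have kt: "(k \<longlongrightarrow> x0) ?F" and pt: "(p \<longlongrightarrow> x0) ?F"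
    using curve_in_chart(2)[OF Ck I0 c(1)] curve_in_chart(2)[OF Cp I0 c(1)] c(2) one
    by (simp_all add: k_def[abs_def] p_def[abs_def] x0_def)
  have evk: "\<forall>\<^sub>F s in ?F. s \<in> ?I \<and> commutator G (\<gamma> s) (\<eta> s) \<in> fst c"
    and evp: "\<forall>\<^sub>F s in ?F. s \<in> ?I \<and> \<eta> s \<otimes> \<gamma> s \<in> fst c"
    using curve_in_chart(1)[OF Ck I0 c(1)] curve_in_chart(1)[OF Cp I0 c(1)] c(2) one by simp_all
  \<comment> \<open>Strict differentiability at the scale s^2, with the moving second argument p s
    common to both points.\<close>
  have "((\<lambda>s. (1 / s\<^sup>2) *\<^sub>R (\<mu> (k s, p s) - \<mu> (x0, p s))) \<longlongrightarrow> d\<mu> ((x0, x0), (L, 0))) ?F"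
  proof (rule C1_with_strict[OF \<mu>1 U _ _ ne])
    show "((\<lambda>s. (1 / s\<^sup>2) *\<^sub>R ((k s, p s) - (x0, p s))) \<longlongrightarrow> (L, 0)) ?F"
      using tendsto_Pair[OF L tendsto_const[of "0::'e"]] by (simp add: k_def x0_def)
  qed (intro tendsto_Pair kt pt tendsto_const)+
  moreover have "\<forall>\<^sub>F s in ?F. (1 / s\<^sup>2) *\<^sub>R (\<mu> (k s, p s) - \<mu> (x0, p s)) = (1 / s\<^sup>2) *\<^sub>R (snd c (\<gamma> s \<otimes> \<eta> s) - p s)"
    using evk evp
  proof eventually_elim
    case (elim s)
    then have "\<gamma> s \<in> carrier G" "\<eta> s \<in> carrier G" using curve_carrier \<gamma> \<eta> by auto
    with elim c show ?case by (simp add: \<mu>_def k_def p_def x0_def commutator_mult)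
  qed
  ultimately have "((\<lambda>s. (1 / s\<^sup>2) *\<^sub>R (snd c (\<gamma> s \<otimes> \<eta> s) - p s)) \<longlongrightarrow> d\<mu> ((x0, x0), (L, 0))) ?F"
    by (rule Lim_transform_eventually)
  with B have "?B = d\<mu> ((x0, x0), (L, 0))" by (intro tendsto_unique[of ?F]) auto
  \<comment> \<open>Right multiplication by \<one> is the identity in coordinates, so the derivative
    reproduces L.\<close>
  moreover have "((\<lambda>t. (1 / t) *\<^sub>R (\<mu> ((x0, x0) + t *\<^sub>R (L, 0)) - \<mu> (x0, x0))) \<longlongrightarrow> L) (at 0)"
  proof (rule tendsto_eventually)
    have openc: "open (snd c ` fst c)" using atlas_chart_on[OF c(1)] by (simp add: chart_on_def)
    have z: "((\<lambda>t. x0 + t *\<^sub>R L) \<longlongrightarrow> x0) (at (0::real))"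
      by (rule tendsto_line)
    have \<mu>0: "\<mu> (z, x0) = z" if "z \<in> snd c ` fst c" for z
      using that c atlas_carrier[OF c(1)] by (auto simp: \<mu>_def x0_def)
    have x0: "x0 \<in> snd c ` fst c" using c by (simp add: x0_def)
    from topological_tendstoD[OF z openc x0] eventually_neq_at_within[of 0 0 UNIV]
    show "\<forall>\<^sub>F t in at 0. (1 / t) *\<^sub>R (\<mu> ((x0, x0) + t *\<^sub>R (L, 0)) - \<mu> (x0, x0)) = L"
      by eventually_elim (simp add: \<mu>0 x0)
  qed
  from tendsto_unique[OF _ C1_withD(4)[OF \<mu>1 U] this] have "d\<mu> ((x0, x0), (L, 0)) = L" by simp
  ultimately show ?thesis by simp
qed

section \<open>Reparametrization by the square root\<close>

lemma filterlim_sqrt_at_within: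
  assumes "t \<in> {0..1}"
  shows "filterlim sqrt (at (sqrt t) within {0..1}) (at t within {0..1})"
proof -
  have "\<forall>\<^sub>F s in at t within {0..1}. s \<in> {0..1} \<and> s \<noteq> t" by (simp add: eventually_at_filter)
  then have "\<forall>\<^sub>F s in at t within {0..1}. sqrt s \<in> {0..1} \<and> sqrt s \<noteq> sqrt t"
    by eventually_elim auto
  moreover have "(sqrt \<longlongrightarrow> sqrt t) (at t within {0..1})" by (intro tendsto_real_sqrt tendsto_ident_at)
  ultimately show ?thesis by (auto simp: filterlim_at elim: eventually_mono)
qed

text \<open>At 0 both the velocity and its continuity come from the limits for \<kappa> with
  \<surd>s in place of s. At t > 0 the square root is differentiable and the usual chain rule
  holds.\<close>

lemma sqrt_commutator_curve:
  assumes \<gamma>: "C1_curve (gtop G) (gatlas G) \<gamma>" "\<gamma> 0 = \<one>"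
    and \<eta>: "C1_curve (gtop G) (gatlas G) \<eta>" "\<eta> 0 = \<one>"
  defines "B \<equiv> lie_bracket G (curve_velocity (gatlas G) {0..1} \<gamma> 0) (curve_velocity (gatlas G) {0..1} \<eta> 0)"
    and "\<zeta> \<equiv> \<lambda>t. commutator G (\<gamma> (sqrt t)) (\<eta> (sqrt t))"
  shows "C1_curve (gtop G) (gatlas G) \<zeta>" "curve_velocity (gatlas G) {0..1} \<zeta> 0 = B"
proof -
  let ?I = "{0..1::real}"
  let ?\<kappa> = "\<lambda>t. commutator G (\<gamma> t) (\<eta> t)"
  note C\<kappa> = C1_curve_commutator[OF \<gamma>(1) \<eta>(1)]
  have \<zeta>0: "\<zeta> 0 = \<one>" using \<gamma> \<eta> by (simp add: \<zeta>_def)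
  have lims: "((\<lambda>s. (1 / s) *\<^sub>R (snd c (\<zeta> s) - snd c \<one>)) \<longlongrightarrow> B c) (at 0 within ?I)"
    "((\<lambda>s. (1 / (2 * sqrt s)) *\<^sub>R \<delta> (sqrt s)) \<longlongrightarrow> B c) (at 0 within ?I)"
    if c: "c \<in> gatlas G" "\<one> \<in> fst c" and \<delta>: "curve_deriv c ?\<kappa> \<delta>" for c \<delta>
  proof -
    obtain L where L:
      "((\<lambda>s. (1 / s\<^sup>2) *\<^sub>R (snd c (commutator G (\<gamma> s) (\<eta> s)) - snd c \<one>)) \<longlongrightarrow> L) (at 0 within {0..1})"
      "((\<lambda>s. (1 / (2 * s)) *\<^sub>R \<delta> s) \<longlongrightarrow> L) (at 0 within {0..1})"
      by (rule commutator_curve_limits[OF \<gamma> \<eta> c \<delta>])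
    have "L = B c" unfolding B_def by (rule commutator_curve_limit_eq[OF \<gamma> \<eta> c L(1)])
    have f: "filterlim sqrt (at 0 within ?I) (at 0 within ?I)" using filterlim_sqrt_at_within[of 0] by simp
    show "((\<lambda>s. (1 / (2 * sqrt s)) *\<^sub>R \<delta> (sqrt s)) \<longlongrightarrow> B c) (at 0 within ?I)"
      using filterlim_compose[OF L(2) f] \<open>L = B c\<close> by simp
    \<comment> \<open>The filter restricts s to [0, 1], where the square of the root is s.\<close>
    have "\<forall>\<^sub>F s in at 0 within ?I. (1 / (sqrt s)\<^sup>2) *\<^sub>R (snd c (commutator G (\<gamma> (sqrt s)) (\<eta> (sqrt s))) - snd c \<one>)
        = (1 / s) *\<^sub>R (snd c (\<zeta> s) - snd c \<one>)"
      by (simp add: eventually_at_filter \<zeta>_def)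
    from Lim_transform_eventually[OF filterlim_compose[OF L(1) f] this] \<open>L = B c\<close>
    show "((\<lambda>s. (1 / s) *\<^sub>R (snd c (\<zeta> s) - snd c \<one>)) \<longlongrightarrow> B c) (at 0 within ?I)" by simp
  qed
  show "curve_velocity (gatlas G) ?I \<zeta> 0 = B"
  proof
    fix c
    show "curve_velocity (gatlas G) ?I \<zeta> 0 c = B c"
    proof (cases "c \<in> charts_at (gatlas G) \<one>")
      case True
      then have c: "c \<in> gatlas G" "\<one> \<in> fst c" by (auto simp: charts_at_def)
      obtain \<delta> where "curve_deriv c ?\<kappa> \<delta>" using C\<kappa> c(1) by (auto simp: C1_curve_iff)
      from tendsto_Lim[OF _ lims(1)[OF c this]]
      show ?thesis using True by (simp add: curve_velocity_def \<zeta>0)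
    next
      \<comment> \<open>Both sides are restricted to the charts at \<one>, hence
        \<open>undefined\<close> elsewhere.\<close>
      case False
      then show ?thesis by (simp add: curve_velocity_def \<zeta>0 B_def lie_bracket_def vector_field_bracket_def)
    qed
  qed
  show "C1_curve (gtop G) (gatlas G) \<zeta>"
    unfolding C1_curve_iff
  proof (intro conjI ballI)
    have s: "continuous_map (top_of_set ?I) (top_of_set ?I) sqrt"
      by (auto simp: continuous_on_real_sqrt continuous_on_id)
    have "continuous_map (top_of_set ?I) (gtop G) ?\<kappa>" using C\<kappa> by (simp add: C1_curve_iff)
    from continuous_map_compose[OF s this] show "continuous_map (top_of_set ?I) (gtop G) \<zeta>"
      by (simp add: comp_def \<zeta>_def)
  next
    fix c assume c: "c \<in> gatlas G"
    obtain \<delta> where \<delta>: "curve_deriv c ?\<kappa> \<delta>" using C\<kappa> c by (auto simp: C1_curve_iff)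
    \<comment> \<open>At 0 the second formula would give 0 because of division by zero; the true
      velocity there is B c.\<close>
    define \<delta>' where "\<delta>' t = (if t = 0 then B c else (1 / (2 * sqrt t)) *\<^sub>R \<delta> (sqrt t))" for t
    have "((\<lambda>s. (1 / (s - t)) *\<^sub>R (snd c (\<zeta> s) - snd c (\<zeta> t))) \<longlongrightarrow> \<delta>' t) (at t within ?I) \<and>
        (\<delta>' \<longlongrightarrow> \<delta>' t) (at t within ?I)" if t: "t \<in> ?I" "\<zeta> t \<in> fst c" for t
    proof (cases "t = 0")
      case True
      have "\<one> \<in> fst c" using t(2) True \<zeta>0 by simp
      note l = lims[OF c this \<delta>]
      have "\<delta>' 0 = B c" by (simp add: \<delta>'_def)
      have "\<forall>\<^sub>F s in at 0 within ?I. (1 / (2 * sqrt s)) *\<^sub>R \<delta> (sqrt s) = \<delta>' s"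
        by (simp add: eventually_at_filter \<delta>'_def)
      from Lim_transform_eventually[OF l(2) this] l(1) show ?thesis
        by (simp add: True \<zeta>0 \<open>\<delta>' 0 = B c\<close>)
    next
      case False
      then have t0: "t > 0" using t(1) by simp
      have st: "sqrt t \<in> ?I" "?\<kappa> (sqrt t) \<in> fst c" using t by (simp_all add: \<zeta>_def)
      note f = filterlim_sqrt_at_within[OF t(1)]
      \<comment> \<open>From s - t = (\<surd>s - \<surd>t)(\<surd>s + \<surd>t), the quotient of
        \<zeta> is that of \<kappa> at \<surd>t times a convergent scalar.\<close>
      have "((\<lambda>s. (1 / (sqrt s - sqrt t)) *\<^sub>R (snd c (\<zeta> s) - snd c (\<zeta> t))) \<longlongrightarrow> \<delta> (sqrt t)) (at t within ?I)"
        using filterlim_compose[OF curve_derivD(1)[OF \<delta> st] f] by (simp add: \<zeta>_def)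
      moreover have q: "((\<lambda>s. 1 / (sqrt s + sqrt t)) \<longlongrightarrow> 1 / (2 * sqrt t)) (at t within ?I)"
        using t0 by (auto intro!: tendsto_eq_intros)
      ultimately have "((\<lambda>s. (1 / (sqrt s + sqrt t)) *\<^sub>R ((1 / (sqrt s - sqrt t)) *\<^sub>R (snd c (\<zeta> s) - snd c (\<zeta> t))))
          \<longlongrightarrow> \<delta>' t) (at t within ?I)"
        using tendsto_scaleR_lcs t0 by (fastforce simp: \<delta>'_def)
      moreover have "\<forall>\<^sub>F s in at t within ?I. (1 / (sqrt s + sqrt t)) *\<^sub>R ((1 / (sqrt s - sqrt t)) *\<^sub>R (snd c (\<zeta> s) - snd c (\<zeta> t)))
          = (1 / (s - t)) *\<^sub>R (snd c (\<zeta> s) - snd c (\<zeta> t))"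
      proof -
        have "\<forall>\<^sub>F s in at t within ?I. s \<in> ?I" by (simp add: eventually_at_filter)
        then show ?thesis
        proof eventually_elim
          case (elim s)
          have "(sqrt s + sqrt t) * (sqrt s - sqrt t) = s - t"
            using elim t0 by (simp add: square_diff_square_factored[symmetric])
          then show ?case by simp
        qed
      qed
      ultimately have "((\<lambda>s. (1 / (s - t)) *\<^sub>R (snd c (\<zeta> s) - snd c (\<zeta> t))) \<longlongrightarrow> \<delta>' t) (at t within ?I)"
        by (rule Lim_transform_eventually)
      moreover have "(\<delta>' \<longlongrightarrow> \<delta>' t) (at t within ?I)"
      proof -
        have "continuous_map (top_of_set ?I) (gtop G) ?\<kappa>" using C\<kappa> by (simp add: C1_curve_iff)
        from filterlim_compose[OF curve_deriv_tendsto[OF this atlas_chart_on[OF c] \<delta> st] f]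
        have "((\<lambda>s. \<delta> (sqrt s)) \<longlongrightarrow> \<delta> (sqrt t)) (at t within ?I)" .
        moreover have "((\<lambda>s. 1 / (2 * sqrt s)) \<longlongrightarrow> 1 / (2 * sqrt t)) (at t within ?I)"
          using t0 by (auto intro!: tendsto_eq_intros)
        ultimately have "((\<lambda>s. (1 / (2 * sqrt s)) *\<^sub>R \<delta> (sqrt s)) \<longlongrightarrow> (1 / (2 * sqrt t)) *\<^sub>R \<delta> (sqrt t)) (at t within ?I)"
          by (intro tendsto_scaleR_lcs)
        moreover have "\<forall>\<^sub>F s in at t within ?I. s \<noteq> 0"
          using tendsto_imp_eventually_ne[OF tendsto_ident_at, of t 0] t0 by simp
        then have "\<forall>\<^sub>F s in at t within ?I. (1 / (2 * sqrt s)) *\<^sub>R \<delta> (sqrt s) = \<delta>' s"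
          by eventually_elim (simp add: \<delta>'_def)
        ultimately show ?thesis using t0 by (auto simp: \<delta>'_def elim: Lim_transform_eventually)
      qed
      ultimately show ?thesis by blast
    qed
    then have "curve_deriv c \<zeta> \<delta>'"
      unfolding curve_deriv_def continuous_on_def
      by (blast intro: tendsto_within_subset[OF _ Int_lower1])
    then show "\<exists>\<delta>. curve_deriv c \<zeta> \<delta>" by (rule exI[where x = \<delta>'])
  qed
qed

end

section \<open>The commutator property from the Trotter property\<close>

theorem theoremH:
  fixes G :: "('g, 'e::locally_convex_space) lie_structure"
    and E :: "('g, 'e) tvec \<Rightarrow> 'g"
  assumes "lie_group G"
    and "strong_trotter_property G E"
  shows "strong_commutator_property G E"
  unfolding strong_commutator_property_def
proof (intro conjI allI impI)
  show "smooth_exponential G E" using assms(2) by (simp add: strong_trotter_property_def)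
  fix \<gamma> \<eta>
  assume *: "C1_curve (gtop G) (gatlas G) \<gamma> \<and> \<gamma> 0 = \<one>\<^bsub>G\<^esub> \<and> C1_curve (gtop G) (gatlas G) \<eta> \<and> \<eta> 0 = \<one>\<^bsub>G\<^esub>"
  interpret group G using assms(1) by (simp add: lie_group_def)
  define \<zeta> where "\<zeta> t = commutator G (\<gamma> (sqrt t)) (\<eta> (sqrt t))" for t
  let ?B = "lie_bracket G (curve_velocity (gatlas G) {0..1} \<gamma> 0) (curve_velocity (gatlas G) {0..1} \<eta> 0)"
  have "C1_curve (gtop G) (gatlas G) \<zeta>" and v: "curve_velocity (gatlas G) {0..1} \<zeta> 0 = ?B"
    using sqrt_commutator_curve[OF assms(1), of \<gamma> \<eta>] * unfolding \<zeta>_def[abs_def] by blast+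
  moreover have "\<zeta> 0 = \<one>\<^bsub>G\<^esub>" using * by (simp add: \<zeta>_def)
  ultimately have lim: "converges_compactly G (\<lambda>n t. \<zeta> (t / real n) [^]\<^bsub>G\<^esub> n) (\<lambda>t. E (lie_scale G t ?B))"
    using assms(2) by (auto simp: strong_trotter_property_def)
  have sq: "filterlim (\<lambda>n::nat. n\<^sup>2) sequentially sequentially"
    by (rule filterlim_subseq) (simp add: strict_mono_def power_strict_mono)
  \<comment> \<open>Since \<surd>(t / n^2) = \<surd>t / n, the exponent n^2 is exactly the index at
    which the Trotter limit is taken.\<close>
  have eq: "\<zeta> (t / real (n\<^sup>2)) = \<gamma> (sqrt t / real n) \<otimes>\<^bsub>G\<^esub> \<eta> (sqrt t / real n) \<otimes>\<^bsub>G\<^esub>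
      inv\<^bsub>G\<^esub> (\<gamma> (sqrt t / real n)) \<otimes>\<^bsub>G\<^esub> inv\<^bsub>G\<^esub> (\<eta> (sqrt t / real n))" for t n
    by (simp add: \<zeta>_def commutator_def real_sqrt_divide)
  show "converges_compactly G (\<lambda>n t. (\<gamma> (sqrt t / real n) \<otimes>\<^bsub>G\<^esub> \<eta> (sqrt t / real n) \<otimes>\<^bsub>G\<^esub>
      inv\<^bsub>G\<^esub> (\<gamma> (sqrt t / real n)) \<otimes>\<^bsub>G\<^esub> inv\<^bsub>G\<^esub> (\<eta> (sqrt t / real n))) [^]\<^bsub>G\<^esub> (n\<^sup>2)) (\<lambda>t. E (lie_scale G t ?B))"
    unfolding converges_compactly_def eq[symmetric]
  proof (intro allI impI)
    fix K :: "real set" and U V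
    assume "compact K \<and> K \<subseteq> {0..} \<and> openin (gtop G) V \<and> \<one>\<^bsub>G\<^esub> \<in> V \<and> V \<subseteq> U \<and> U \<subseteq> carrier G"
    then have "\<forall>\<^sub>F n in sequentially. \<forall>t\<in>K. \<zeta> (t / real n) [^]\<^bsub>G\<^esub> n \<in>
        (E (lie_scale G t ?B) <#\<^bsub>G\<^esub> U) \<inter> (U #>\<^bsub>G\<^esub> E (lie_scale G t ?B))"
      using lim unfolding converges_compactly_def by blast
    then show "\<forall>\<^sub>F n in sequentially. \<forall>t\<in>K. \<zeta> (t / real (n\<^sup>2)) [^]\<^bsub>G\<^esub> (n\<^sup>2) \<in>
        (E (lie_scale G t ?B) <#\<^bsub>G\<^esub> U) \<inter> (U #>\<^bsub>G\<^esub> E (lie_scale G t ?B))"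
      by (rule eventually_compose_filterlim[OF _ sq])
  qed
qed

end
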